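(* Let $n\ge 1$, $b>0$ and $(a,r)\in\mathbb{R}^n\times\mathbb{R}^n$. Let $I(a,r)\subset\mathbb{R}$ be the (possibly empty) open interval on which the functions $g_0,g_1,\ldots,g_n$ are all defined and strictly positive, where $g_0(x)=x$ and $g_{i+1}(x)=a_{i+1}+g_i(x)^{r_{i+1}}$ for $0\le i\le n-1$. Let $\varphi:I(a,r)\to\mathbb{R}$ be the analytic function $$\varphi(x)=g_n(x)-b\,x=a_n+(a_{n-1}+\cdots(a_1+x^{r_1})^{r_2}\cdots)^{r_n}-b\,x .$$ Then the number of isolated roots of $\varphi$ on $I(a,r)$, counted with multiplicities, is bounded by $\mathrm{DD}(n)+2$, where $\mathrm{DD}(n)$ is the derivation-division number defined in the context.
   Context: Definition of $\mathrm{DD}(n)$. Fix $n\ge 1$ and let $R=\mathbb{Z}[R_1,\ldots,R_n]$ (polynomial ring). For $0\le j\le n$ let $\mathbb{L}_j=R[x_1^{\pm},y_1^{\pm},\ldots,x_j^{\pm},y_j^{\pm}]$ be the ring of Laurent polynomials in $x_1,y_1,\ldots,x_j,y_j$ over $R$ ($\mathbb{L}_0=R$). The degree of a monomial $c\,x^ky^l$ ($c\in R\setminus\{0\}$, $k,l\in\mathbb{Z}^j$) is the vector $k+l\in\mathbb{Z}^j$. A nonzero element of $\mathbb{L}_j$ is homogeneous if all its monomials have the same degree, denoted $\mathrm{pdeg}(p)=(\mathrm{pdeg}_1(p),\ldots,\mathrm{pdeg}_j(p))$. Put $\Delta_0=1$, $\Delta_i=R_1\cdots R_i$. The derivation $\partial:\mathbb{L}_n\to\mathbb{L}_n$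 vanishes on $R$ and satisfies $$\partial(x_1)=\partial(y_1)=\Delta_1x_1,\qquad \partial(x_j)=\partial(y_j)=\Delta_j\,x_j\,\frac{x_1\cdots x_{j-1}}{y_1\cdots y_{j-1}}\quad (j\ge 2).$$ It maps each $\mathbb{L}_j$ to itself, and it maps a homogeneous element either to $0$ or to a homogeneous element of the same degree. Regularization monomial $\mathrm{reg}(p)$ of a nonzero homogeneous $p\in\mathbb{L}_j$, defined by induction on $j$: for $j=0$, $\mathrm{reg}(p)=1$; for $j\ge1$, put $m=\mathrm{pdeg}_j(p)$ and write $p=\sum_{i=n_0}^{n_1}q_i\,x_j^{i}y_j^{m-i}$ with integers $n_0\le n_1$ (possibly negative), $q_i\in\mathbb{L}_{j-1}$ zero or homogeneous, $q_{n_0}\ne0$, $q_{n_1}\neq 0$; then $\mathrm{reg}(p)=x_j^{n_0}y_j^{m-n_1}\,\mathrm{reg}(q_{n_0})$. Derivation-division sequence: for a nonzero homogeneous $p$, set $p^{(0)}=p$ and $p^{(k+1)}=\partial p^{(k)}/\mathrm{reg}(\partial p^{(k)})$ if $\partial p^{(k)}\ne0$, and $p^{(k+1)}=0$ if $\partial p^{(k)}=0$. $\mathrm{DD}(p)$ is the smallest integer $k\ge0$ with $p^{(k)}\in R$. Finally $\mathrm{DD}(n):=\mathrm{DD}(p)$ for the polynomial (for which such a $k$ exists) $$p=\Delta_n\sum_{j=1}^{n}(\Delta_j-\Delta_{j-1})\Big(\prod_{i=1}^{j-1}x_i\Big)\Big(\prod_{i=j}^{n-1}y_i\Big)\in\mathbb{L}_{n-1}.$$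 *)

theory Defs
  imports "HOL-Analysis.Analysis" "HOL-Library.Poly_Mapping"
begin

section \<open>Laurent polynomials and the derivation\<close>

text \<open>
  The coefficient ring is \<open>\<int>[R\<^sub>1, R\<^sub>2, \<dots>]\<close>.  We use countably many
  indeterminates \<open>R\<^sub>i\<close>, \<open>x\<^sub>j\<close>, \<open>y\<^sub>j\<close> at once; the rings \<open>\<int>[R\<^sub>1, \<dots>, R\<^sub>n]\<close> and
  \<open>\<bbbL>\<^sub>j\<close> are subrings of those below (the index 0 is never used), and everything that
  enters \<open>DD n\<close> lives in \<open>\<bbbL>\<^sub>n\<^sub>-\<^sub>1\<close> over \<open>\<int>[R\<^sub>1, \<dots>, R\<^sub>n]\<close>.
\<close>

type_synonym cring = "(nat \<Rightarrow>\<^sub>0 nat) \<Rightarrow>\<^sub>0 int"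

datatype lvar = X nat | Y nat

type_synonym lmon = "lvar \<Rightarrow>\<^sub>0 int"

type_synonym laurent = "lmon \<Rightarrow>\<^sub>0 cring"

definition Rvar :: "nat \<Rightarrow> cring" where
  "Rvar i = Poly_Mapping.single (Poly_Mapping.single i 1) 1"

definition Delta :: "nat \<Rightarrow> cring" where
  "Delta i = (\<Prod>k=1..i. Rvar k)"

definition const :: "cring \<Rightarrow> laurent" where
  "const c = Poly_Mapping.single 0 c"

definition lmonom :: "lmon \<Rightarrow> laurent" where
  "lmonom e = Poly_Mapping.single e 1"

definition var :: "lvar \<Rightarrow> laurent" where
  "var v = lmonom (Poly_Mapping.single v 1)"

definition inv_var :: "lvar \<Rightarrow> laurent" where
  "inv_var v = lmonom (Poly_Mapping.single v (- 1))"

fun index :: "lvar \<Rightarrow> nat" where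
  "index (X j) = j"
| "index (Y j) = j"

definition deriv_var :: "lvar \<Rightarrow> laurent" where
  "deriv_var v = const (Delta (index v)) * var (X (index v)) *
     (\<Prod>i\<in>{1..<index v}. var (X i) * inv_var (Y i))"

text \<open>
  \<open>\<partial>(c \<cdot> \<Prod>\<^sub>v v\<^bsup>e v\<^esup>) = c \<cdot> \<Sum>\<^sub>v e v \<cdot> v\<^bsup>e v - 1\<^esup> \<cdot> (\<Prod>\<^bsub>w \<noteq> v\<^esub> w\<^bsup>e w\<^esup>) \<cdot> \<partial> v\<close>; see
  \<open>ld_unique\<close> for the characterization of \<open>ld\<close> as the only derivation
  with the prescribed values.
\<close>

definition ld :: "laurent \<Rightarrow> laurent" where
  "ld p = (\<Sum>e\<in>Poly_Mapping.keys p. \<Sum>v\<in>Poly_Mapping.keys e.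
     Poly_Mapping.single (e - Poly_Mapping.single v 1) (of_int (Poly_Mapping.lookup e v) * Poly_Mapping.lookup p e)
       * deriv_var v)"


section \<open>Regularization and the derivation-division number\<close>

definition mdeg :: "lmon \<Rightarrow> nat \<Rightarrow> int" where
  "mdeg e i = Poly_Mapping.lookup e (X i) + Poly_Mapping.lookup e (Y i)"

definition homogeneous :: "laurent \<Rightarrow> bool" where
  "homogeneous p \<longleftrightarrow> p \<noteq> 0 \<and> (\<exists>d. \<forall>e\<in>Poly_Mapping.keys p. mdeg e = d)"

definition pdeg :: "laurent \<Rightarrow> nat \<Rightarrow> int" where
  "pdeg p = (THE d. \<forall>e\<in>Poly_Mapping.keys p. mdeg e = d)"

text \<open>
  For \<open>p\<close> homogeneous with \<open>m = pdeg p j\<close>, \<open>xcoeff j p i\<close> is the coefficient \<open>q\<^sub>i\<close> in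
  \<open>p = \<Sum>\<^sub>i q\<^sub>i x\<^sub>j\<^bsup>i\<^esup> y\<^sub>j\<^bsup>m - i\<^esup>\<close>.
\<close>

definition xcoeff :: "nat \<Rightarrow> laurent \<Rightarrow> int \<Rightarrow> laurent" where
  "xcoeff j p i = (\<Sum>e\<in>{e\<in>Poly_Mapping.keys p. Poly_Mapping.lookup e (X j) = i}.
     Poly_Mapping.single
       (e - Poly_Mapping.single (X j) i - Poly_Mapping.single (Y j) (pdeg p j - i))
       (Poly_Mapping.lookup p e))"

definition xmin :: "nat \<Rightarrow> laurent \<Rightarrow> int" where
  "xmin j p = Min {i. xcoeff j p i \<noteq> 0}"

definition xmax :: "nat \<Rightarrow> laurent \<Rightarrow> int" where
  "xmax j p = Max {i. xcoeff j p i \<noteq> 0}"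

text \<open>
  \<open>reg j p\<close> is the exponent vector of the regularization monomial of \<open>p \<in> \<bbbL>\<^sub>j\<close>, so that
  dividing by this monomial is multiplying by \<open>lmonom (- reg j p)\<close>.
\<close>

fun reg :: "nat \<Rightarrow> laurent \<Rightarrow> lmon" where
  "reg 0 p = 0"
| "reg (Suc j) p =
     Poly_Mapping.single (X (Suc j)) (xmin (Suc j) p)
     + Poly_Mapping.single (Y (Suc j)) (pdeg p (Suc j) - xmax (Suc j) p)
     + reg j (xcoeff (Suc j) p (xmin (Suc j) p))"

fun dd_seq :: "nat \<Rightarrow> laurent \<Rightarrow> nat \<Rightarrow> laurent" where
  "dd_seq j p 0 = p"
| "dd_seq j p (Suc k) =
     (let q = ld (dd_seq j p k) in if q = 0 then 0 else q * lmonom (- reg j q))"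

definition DD_poly :: "nat \<Rightarrow> laurent \<Rightarrow> nat" where
  "DD_poly j p = (LEAST k. dd_seq j p k \<in> range const)"

definition dd_start :: "nat \<Rightarrow> laurent" where
  "dd_start n = const (Delta n) *
     (\<Sum>j=1..n. const (Delta j - Delta (j - 1)) *
        (\<Prod>i\<in>{1..<j}. var (X i)) * (\<Prod>i\<in>{j..<n}. var (Y i)))"

definition DD :: "nat \<Rightarrow> nat" where
  "DD n = DD_poly (n - 1) (dd_start n)"


section \<open>The functions of the real variable\<close>

fun g :: "(nat \<Rightarrow> real) \<Rightarrow> (nat \<Rightarrow> real) \<Rightarrow> nat \<Rightarrow> real \<Rightarrow> real" where
  "g a r 0 x = x"
| "g a r (Suc i) x = a (Suc i) + g a r i x powr r (Suc i)"

text \<open>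
  \<open>g a r (Suc i)\<close> is meaningful as soon as \<open>g a r i\<close> is positive, so the positivity of all
  of \<open>g\<^sub>0, \<dots>, g\<^sub>n\<close> also expresses that they are all defined.
\<close>

definition dom_I :: "(nat \<Rightarrow> real) \<Rightarrow> (nat \<Rightarrow> real) \<Rightarrow> nat \<Rightarrow> real set" where
  "dom_I a r n = {x. \<forall>i\<le>n. 0 < g a r i x}"

definition phi :: "(nat \<Rightarrow> real) \<Rightarrow> (nat \<Rightarrow> real) \<Rightarrow> nat \<Rightarrow> real \<Rightarrow> real \<Rightarrow> real" where
  "phi a r n b x = g a r n x - b * x"

definition isolated_roots :: "(real \<Rightarrow> real) \<Rightarrow> real set \<Rightarrow> real set" where
  "isolated_roots f S = {x. x isolated_in {t\<in>S. f t = 0}}"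

text \<open>The order of vanishing at \<open>x\<close> of a function that is analytic near \<open>x\<close>.\<close>

definition root_mult :: "(real \<Rightarrow> real) \<Rightarrow> real \<Rightarrow> nat" where
  "root_mult f x = (LEAST k. (deriv ^^ k) f x \<noteq> 0)"


section \<open>Checks of the definitions\<close>

lemma ld_alt:
  assumes "finite A" "Poly_Mapping.keys p \<subseteq> A" "finite B" "\<forall>e\<in>A. Poly_Mapping.keys e \<subseteq> B"
  shows "ld p = (\<Sum>e\<in>A. \<Sum>v\<in>B.
     Poly_Mapping.single (e - Poly_Mapping.single v 1) (of_int (Poly_Mapping.lookup e v) * Poly_Mapping.lookup p e)
       * deriv_var v)"
proof -
  have "ld p = (\<Sum>e\<in>Poly_Mapping.keys p. \<Sum>v\<in>B.
     Poly_Mapping.single (e - Poly_Mapping.single v 1) (of_int (Poly_Mapping.lookup e v) * Poly_Mapping.lookup p e)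
       * deriv_var v)"
    unfolding ld_def
  proof (intro sum.cong[OF refl])
    fix e assume "e \<in> Poly_Mapping.keys p"
    then have "Poly_Mapping.keys e \<subseteq> B" using assms by blast
    then show "(\<Sum>v\<in>Poly_Mapping.keys e. Poly_Mapping.single (e - Poly_Mapping.single v 1)
          (of_int (Poly_Mapping.lookup e v) * Poly_Mapping.lookup p e) * deriv_var v) =
        (\<Sum>v\<in>B. Poly_Mapping.single (e - Poly_Mapping.single v 1)
          (of_int (Poly_Mapping.lookup e v) * Poly_Mapping.lookup p e) * deriv_var v)"
      using \<open>finite B\<close> by (intro sum.mono_neutral_left) (auto simp: in_keys_iff)
  qed
  also have "\<dots> = (\<Sum>e\<in>A. \<Sum>v\<in>B.
     Poly_Mapping.single (e - Poly_Mapping.single v 1) (of_int (Poly_Mapping.lookup e v) * Poly_Mapping.lookup p e)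
       * deriv_var v)"
    using assms by (intro sum.mono_neutral_left) (auto simp: in_keys_iff)
  finally show ?thesis .
qed

lemma ld_add: "ld (p + q) = ld p + ld q"
proof -
  define A where "A = Poly_Mapping.keys p \<union> Poly_Mapping.keys q"
  define B where "B = (\<Union>e\<in>A. Poly_Mapping.keys e)"
  have fin: "finite A" "finite B" by (auto simp: A_def B_def)
  have sub: "Poly_Mapping.keys p \<subseteq> A" "Poly_Mapping.keys q \<subseteq> A" "Poly_Mapping.keys (p + q) \<subseteq> A" "\<forall>e\<in>A. Poly_Mapping.keys e \<subseteq> B"
    using Poly_Mapping.keys_add[of p q] by (auto simp: A_def B_def)
  show ?thesis
    unfolding ld_alt[OF fin(1) sub(1) fin(2) sub(4)] ld_alt[OF fin(1) sub(2) fin(2) sub(4)]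
      ld_alt[OF fin(1) sub(3) fin(2) sub(4)]
    by (simp add: lookup_add distrib_left distrib_right single_add sum.distrib)
qed

lemma ld_0 [simp]: "ld 0 = 0"
  by (simp add: ld_def)

lemma ld_sum: "ld (sum f A) = (\<Sum>i\<in>A. ld (f i))"
  by (induction A rule: infinite_finite_induct) (auto simp: ld_add)

lemma ld_single:
  assumes "finite B" "Poly_Mapping.keys e \<subseteq> B"
  shows "ld (Poly_Mapping.single e c) = (\<Sum>v\<in>B.
     Poly_Mapping.single (e - Poly_Mapping.single v 1) (of_int (Poly_Mapping.lookup e v) * c) * deriv_var v)"
  by (subst ld_alt[of "{e}" _ B]) (use assms in auto)

lemma laurent_expand: "(p :: laurent) = (\<Sum>e\<in>Poly_Mapping.keys p. Poly_Mapping.single e (Poly_Mapping.lookup p e))"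
  by (rule poly_mapping_eqI) (auto simp: lookup_sum lookup_single when_def sum.delta in_keys_iff)

lemma ld_mult_single:
  "ld (Poly_Mapping.single e c * Poly_Mapping.single e' c') =
   ld (Poly_Mapping.single e c) * Poly_Mapping.single e' c' +
   Poly_Mapping.single e c * ld (Poly_Mapping.single e' c')"
proof -
  define B where "B = Poly_Mapping.keys e \<union> Poly_Mapping.keys e'"
  have B: "finite B" "Poly_Mapping.keys e \<subseteq> B" "Poly_Mapping.keys e' \<subseteq> B" "Poly_Mapping.keys (e + e') \<subseteq> B"
    using Poly_Mapping.keys_add[of e e'] by (auto simp: B_def)
  have "ld (Poly_Mapping.single e c * Poly_Mapping.single e' c') =
    (\<Sum>v\<in>B. Poly_Mapping.single (e + e' - Poly_Mapping.single v 1)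
       (of_int (Poly_Mapping.lookup (e + e') v) * (c * c')) * deriv_var v)"
    by (simp add: mult_single ld_single[OF B(1,4)])
  also have "\<dots> = (\<Sum>v\<in>B. (Poly_Mapping.single (e - Poly_Mapping.single v 1)
       (of_int (Poly_Mapping.lookup e v) * c) * deriv_var v) * Poly_Mapping.single e' c'
      + Poly_Mapping.single e c * (Poly_Mapping.single (e' - Poly_Mapping.single v 1)
       (of_int (Poly_Mapping.lookup e' v) * c') * deriv_var v))"
  proof (rule sum.cong[OF refl], rule sym, goal_cases)
    case (1 v)
    have 1: "e - Poly_Mapping.single v 1 + e' = e + e' - Poly_Mapping.single v 1"
      and 2: "e + (e' - Poly_Mapping.single v 1) = e + e' - Poly_Mapping.single v 1"
      by (simp_all add: algebra_simps)
    have "(Poly_Mapping.single (e - Poly_Mapping.single v 1)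
       (of_int (Poly_Mapping.lookup e v) * c) * deriv_var v) * Poly_Mapping.single e' c'
      + Poly_Mapping.single e c * (Poly_Mapping.single (e' - Poly_Mapping.single v 1)
       (of_int (Poly_Mapping.lookup e' v) * c') * deriv_var v)
      = (Poly_Mapping.single (e - Poly_Mapping.single v 1) (of_int (Poly_Mapping.lookup e v) * c)
           * Poly_Mapping.single e' c'
         + Poly_Mapping.single e c * Poly_Mapping.single (e' - Poly_Mapping.single v 1)
             (of_int (Poly_Mapping.lookup e' v) * c')) * deriv_var v"
      by (simp add: algebra_simps)
    also have "\<dots> = Poly_Mapping.single (e + e' - Poly_Mapping.single v 1)
       (of_int (Poly_Mapping.lookup (e + e') v) * (c * c')) * deriv_var v"
      unfolding mult_single 1 2 single_add[symmetric]
      by (simp add: lookup_add algebra_simps)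
    finally show ?case .
  qed
  also have "\<dots> = ld (Poly_Mapping.single e c) * Poly_Mapping.single e' c' +
      Poly_Mapping.single e c * ld (Poly_Mapping.single e' c')"
    by (simp add: sum.distrib sum_distrib_left sum_distrib_right ld_single[OF B(1,2)]
        ld_single[OF B(1,3)])
  finally show ?thesis .
qed

lemma ld_mult: "ld (p * q) = ld p * q + p * ld q"
proof -
  define P where "P = (\<lambda>e. Poly_Mapping.single e (Poly_Mapping.lookup p e))"
  define Q where "Q = (\<lambda>e. Poly_Mapping.single e (Poly_Mapping.lookup q e))"
  have p: "p = sum P (Poly_Mapping.keys p)" and q: "q = sum Q (Poly_Mapping.keys q)"
    unfolding P_def Q_def by (fact laurent_expand)+
  have PQ: "ld (P e * Q e') = ld (P e) * Q e' + P e * ld (Q e')" for e e'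
    unfolding P_def Q_def by (rule ld_mult_single)
  have "ld (sum P (Poly_Mapping.keys p) * sum Q (Poly_Mapping.keys q)) =
    (\<Sum>e\<in>Poly_Mapping.keys p. \<Sum>e'\<in>Poly_Mapping.keys q. ld (P e) * Q e' + P e * ld (Q e'))"
    by (simp add: sum_product ld_sum PQ)
  also have "\<dots> = ld (sum P (Poly_Mapping.keys p)) * sum Q (Poly_Mapping.keys q) + sum P (Poly_Mapping.keys p) * ld (sum Q (Poly_Mapping.keys q))"
    by (simp add: sum_product ld_sum sum.distrib)
  finally show ?thesis using p q by simp
qed

lemma ld_const: "ld (const c) = 0"
  unfolding const_def by (subst ld_single[of "{}"]) auto

lemma ld_var: "ld (var v) = deriv_var v"
  unfolding var_def lmonom_def by (subst ld_single[of "{v}"]) auto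

lemma ld_x:
  "ld (var (X j)) = const (Delta j) * var (X j) * (\<Prod>i\<in>{1..<j}. var (X i) * inv_var (Y i))"
  by (simp add: ld_var deriv_var_def)

lemma ld_y: "ld (var (Y j)) = ld (var (X j))"
  by (simp add: ld_var deriv_var_def)

lemma var_inv_var: "var v * inv_var v = 1"
  by (simp add: var_def inv_var_def lmonom_def mult_single flip: single_add)

lemma lmonom_add: "lmonom (e + e') = lmonom e * lmonom e'"
  by (simp add: lmonom_def mult_single)

lemma lmonom_0: "lmonom 0 = 1"
  by (simp add: lmonom_def)

lemma lmonom_induct [case_names zero var inv_var]:
  assumes z: "P 0"
    and v: "\<And>e v. P e \<Longrightarrow> P (e + Poly_Mapping.single v 1)"
    and i: "\<And>e v. P e \<Longrightarrow> P (e + Poly_Mapping.single v (- 1))"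
  shows "P (e :: lmon)"
proof -
  have step: "P (e + Poly_Mapping.single v k)" if "P e" for e v and k :: int
    using that
  proof (induction k rule: int_induct[where k = 0])
    case base then show ?case by simp
  next
    case (step1 k)
    have "P (e + Poly_Mapping.single v k + Poly_Mapping.single v 1)"
      using step1 by (intro v) auto
    then show ?case by (simp add: single_add add.assoc)
  next
    case (step2 k)
    have "P (e + Poly_Mapping.single v k + Poly_Mapping.single v (- 1))"
      using step2 by (intro i) auto
    moreover have "Poly_Mapping.single v (k - 1) =
        Poly_Mapping.single v k + Poly_Mapping.single v (- 1)"
      by (subst single_add[symmetric]) simp
    ultimately show ?case by (simp add: add.assoc)
  qed
  have "P (\<Sum>v\<in>A. Poly_Mapping.single v (Poly_Mapping.lookup e v))" if "finite A" for A
    using that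
  proof induction
    case empty then show ?case using z by simp
  next
    case (insert a A)
    then show ?case using step[of "\<Sum>v\<in>A. Poly_Mapping.single v (Poly_Mapping.lookup e v)" a "Poly_Mapping.lookup e a"]
      by (simp add: add.commute)
  qed
  moreover have "e = (\<Sum>v\<in>Poly_Mapping.keys e. Poly_Mapping.single v (Poly_Mapping.lookup e v))"
    by (rule poly_mapping_eqI) (auto simp: lookup_sum lookup_single when_def sum.delta in_keys_iff)
  ultimately show ?thesis by (metis finite_keys)
qed

lemma ld_unique:
  assumes add: "\<And>p q. D (p + q) = D p + D q"
    and mult: "\<And>p q. D (p * q) = D p * q + p * D q"
    and const: "\<And>c. D (const c) = 0"
    and x: "\<And>j. D (var (X j)) = const (Delta j) * var (X j) *
              (\<Prod>i\<in>{1..<j}. var (X i) * inv_var (Y i))"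
    and y: "\<And>j. D (var (Y j)) = D (var (X j))"
  shows "D = ld"
proof
  have var: "D (var v) = ld (var v)" for v
    by (cases v) (simp_all add: x y ld_x ld_y)
  have one: "D 1 = 0" "ld 1 = 0"
    using const[of 1] ld_const[of 1] by (simp_all add: const_def)
  have inv: "D (inv_var v) = ld (inv_var v)" for v
  proof -
    have "D (var v) * inv_var v + var v * D (inv_var v) = 0"
      using mult[of "var v" "inv_var v"] one by (simp add: var_inv_var)
    moreover have "ld (var v) * inv_var v + var v * ld (inv_var v) = 0"
      using ld_mult[of "var v" "inv_var v"] one by (simp add: var_inv_var)
    ultimately have "var v * D (inv_var v) = var v * ld (inv_var v)"
      by (metis var add_left_cancel)
    then have "inv_var v * var v * D (inv_var v) = inv_var v * var v * ld (inv_var v)"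
      by (simp add: mult.assoc)
    then show ?thesis by (simp add: mult.commute[of "inv_var v"] var_inv_var)
  qed
  have mon: "D (lmonom e) = ld (lmonom e)" for e
    by (induction e rule: lmonom_induct)
       (simp_all add: lmonom_0 one lmonom_add mult ld_mult var inv
          flip: var_def inv_var_def)
  have sing: "D (Poly_Mapping.single e c) = ld (Poly_Mapping.single e c)" for e c
  proof -
    have "Poly_Mapping.single e c = Defs.const c * lmonom e"
      by (simp add: const_def lmonom_def mult_single)
    then show ?thesis by (simp add: mult ld_mult const ld_const mon)
  qed
  have zero: "D 0 = 0" using add[of 0 0] by simp
  have sum: "D (sum f A) = (\<Sum>i\<in>A. D (f i))" for f :: "lmon \<Rightarrow> laurent" and A
    by (induction A rule: infinite_finite_induct) (auto simp: add zero)
  fix p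
  show "D p = ld p"
    by (subst (1 2) laurent_expand) (simp add: sum ld_sum sing)
qed

lemma pdeg_eq:
  assumes "homogeneous p" "e \<in> Poly_Mapping.keys p"
  shows "pdeg p = mdeg e"
  unfolding pdeg_def using assms by (intro the_equality) (auto simp: homogeneous_def)

text \<open>The set in \<open>xmin\<close> and \<open>xmax\<close> is finite and nonempty for homogeneous \<open>p\<close>.\<close>

lemma xcoeff_nonzero:
  assumes "homogeneous p"
  shows "{i. xcoeff j p i \<noteq> 0} = (\<lambda>e. Poly_Mapping.lookup e (X j)) ` Poly_Mapping.keys p"
proof (intro equalityI subsetI)
  fix i assume "i \<in> {i. xcoeff j p i \<noteq> 0}"
  then have "{e\<in>Poly_Mapping.keys p. Poly_Mapping.lookup e (X j) = i} \<noteq> {}"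
    unfolding xcoeff_def by (metis (mono_tags, lifting) mem_Collect_eq sum.empty)
  then show "i \<in> (\<lambda>e. Poly_Mapping.lookup e (X j)) ` Poly_Mapping.keys p" by auto
next
  fix i assume "i \<in> (\<lambda>e. Poly_Mapping.lookup e (X j)) ` Poly_Mapping.keys p"
  then obtain e where e: "e \<in> Poly_Mapping.keys p" "Poly_Mapping.lookup e (X j) = i" by auto
  let ?s = "Poly_Mapping.single (X j) i + Poly_Mapping.single (Y j) (pdeg p j - i)"
  have "Poly_Mapping.lookup (xcoeff j p i) (e - ?s) =
      (\<Sum>e'\<in>{e\<in>Poly_Mapping.keys p. Poly_Mapping.lookup e (X j) = i}. if e' = e then Poly_Mapping.lookup p e' else 0)"
    unfolding xcoeff_def lookup_sum
    by (intro sum.cong refl) (auto simp: lookup_single when_def diff_diff_eq)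
  also have "\<dots> = Poly_Mapping.lookup p e" using e by (simp add: sum.delta)
  finally show "i \<in> {i. xcoeff j p i \<noteq> 0}" using e by (auto simp: in_keys_iff)
qed

lemma homogeneous_expand:
  assumes "homogeneous p"
  shows "p = (\<Sum>i\<in>{i. xcoeff j p i \<noteq> 0}. xcoeff j p i *
           lmonom (Poly_Mapping.single (X j) i + Poly_Mapping.single (Y j) (pdeg p j - i)))"
proof -
  let ?s = "\<lambda>i. Poly_Mapping.single (X j) i + Poly_Mapping.single (Y j) (pdeg p j - i)"
  have "xcoeff j p i * lmonom (?s i) =
      (\<Sum>e\<in>{e\<in>Poly_Mapping.keys p. Poly_Mapping.lookup e (X j) = i}. Poly_Mapping.single e (Poly_Mapping.lookup p e))" for i
    unfolding xcoeff_def lmonom_def sum_distrib_right mult_single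
    by (intro sum.cong refl) (simp add: diff_diff_eq)
  then have "(\<Sum>i\<in>{i. xcoeff j p i \<noteq> 0}. xcoeff j p i * lmonom (?s i)) =
      (\<Sum>i\<in>(\<lambda>e. Poly_Mapping.lookup e (X j)) ` Poly_Mapping.keys p.
         \<Sum>e\<in>{e\<in>Poly_Mapping.keys p. Poly_Mapping.lookup e (X j) = i}. Poly_Mapping.single e (Poly_Mapping.lookup p e))"
    by (simp add: xcoeff_nonzero[OF assms])
  also have "\<dots> = (\<Sum>e\<in>Poly_Mapping.keys p. Poly_Mapping.single e (Poly_Mapping.lookup p e))"
    by (rule sum.image_gen[symmetric]) simp
  also have "\<dots> = p" by (rule laurent_expand[symmetric])
  finally show ?thesis by simp
qed

lemma dom_I_Suc: "dom_I a r (Suc n) = {x \<in> dom_I a r n. 0 < g a r (Suc n) x}"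
  by (auto simp: dom_I_def le_Suc_eq)

lemma continuous_on_g: "m \<le> Suc n \<Longrightarrow> continuous_on (dom_I a r n) (g a r m)"
proof (induction m)
  case (Suc m)
  then show ?case
    by (auto intro!: continuous_intros simp: dom_I_def)
qed (auto intro: continuous_intros)

lemma open_dom_I: "open (dom_I a r n)"
proof (induction n)
  case 0
  have "dom_I a r 0 = {0<..}" by (auto simp: dom_I_def)
  then show ?case by simp
next
  case (Suc n)
  have "dom_I a r (Suc n) = g a r (Suc n) -` {0<..} \<inter> dom_I a r n"
    by (auto simp: dom_I_Suc)
  then show ?case
    using continuous_on_open_vimage[OF Suc] continuous_on_g[of "Suc n" n a r]
    by (metis open_greaterThan le_refl)
qed

lemma g_monotone:
  "mono_on (dom_I a r n) (g a r (Suc n)) \<or> antimono_on (dom_I a r n) (g a r (Suc n))"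
proof (induction n)
  case 0
  show ?case
    by (cases "0 \<le> r (Suc 0)")
       (auto simp: monotone_on_def dom_I_def powr_mono2 powr_mono2')
next
  case (Suc n)
  have pos: "0 < g a r (Suc n) x" if "x \<in> dom_I a r (Suc n)" for x
    using that by (auto simp: dom_I_def simp del: g.simps)
  have sub: "dom_I a r (Suc n) \<subseteq> dom_I a r n" by (auto simp: dom_I_def)
  have e: "g a r (Suc (Suc n)) x = a (Suc (Suc n)) + g a r (Suc n) x powr r (Suc (Suc n))" for x
    by simp
  have pw: "(u::real) powr s \<le> v powr s" if "0 \<le> s" "0 < u" "u \<le> v" for u v s
    using that by (simp add: powr_mono2)
  have pw': "(v::real) powr s \<le> u powr s" if "\<not> 0 \<le> s" "0 < u" "u \<le> v" for u v s
    using that by (simp add: powr_mono2')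
  show ?case
    using Suc
  proof
    assume m: "mono_on (dom_I a r n) (g a r (Suc n))"
    have m': "g a r (Suc n) x \<le> g a r (Suc n) y"
      if "x \<in> dom_I a r (Suc n)" "y \<in> dom_I a r (Suc n)" "x \<le> y" for x y
      using monotone_onD[OF m] that sub by blast
    show ?thesis
      unfolding monotone_on_def e using m' pos pw pw' by (meson add_left_mono)
  next
    assume m: "antimono_on (dom_I a r n) (g a r (Suc n))"
    have m': "g a r (Suc n) y \<le> g a r (Suc n) x"
      if "x \<in> dom_I a r (Suc n)" "y \<in> dom_I a r (Suc n)" "x \<le> y" for x y
      using monotone_onD[OF m] that sub by blast
    show ?thesis
      unfolding monotone_on_def e using m' pos pw pw' by (meson add_left_mono)
  qed
qed

lemma is_interval_dom_I: "is_interval (dom_I a r n)"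
proof (induction n)
  case 0
  have "dom_I a r 0 = {0<..}" by (auto simp: dom_I_def)
  then show ?case by (simp add: is_interval_1)
next
  case (Suc n)
  show ?case
    unfolding is_interval_1
  proof (intro ballI allI impI)
    fix x y t
    assume xy: "x \<in> dom_I a r (Suc n)" "y \<in> dom_I a r (Suc n)" and t: "x \<le> t \<and> t \<le> y"
    have xyn: "x \<in> dom_I a r n" "y \<in> dom_I a r n" using xy by (auto simp: dom_I_Suc)
    then have tn: "t \<in> dom_I a r n" using Suc t unfolding is_interval_1 by blast
    have "g a r (Suc n) x \<le> g a r (Suc n) t \<or> g a r (Suc n) y \<le> g a r (Suc n) t"
      using g_monotone[of a r n] xyn tn t unfolding monotone_on_def by blast
    moreover have "0 < g a r (Suc n) x" "0 < g a r (Suc n) y"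
      using xy by (auto simp: dom_I_Suc simp del: g.simps)
    ultimately have "0 < g a r (Suc n) t" by linarith
    then show "t \<in> dom_I a r (Suc n)" using tn by (simp add: dom_I_Suc)
  qed
qed

end

theory Submission
  imports Defs
begin

text \<open>
  On the domain put \<open>x\<^sub>j = g\<^sub>j\<^sub>-\<^sub>1\<^bsup>r\<^sub>j\<^esup>\<close> and \<open>y\<^sub>j = g\<^sub>j\<close>. Then \<open>\<partial>\<close> becomes the derivation
  \<open>x d/dx\<close>, and \<open>\<phi>''\<close> is the starting polynomial of \<open>DD n\<close> times a monomial, hence times a
  function without zeros. Each derivation-division step costs at most one root by Rolle's theorem,
  because the division is again by a zero-free function, and the sequence ends in a constant.
  Two more applications of Rolle's theorem lead from \<open>\<phi>''\<close> to \<open>\<phi>\<close>. Working backwards from the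
  constant also shows that each function is identically zero or has only zeros of finite order, so
  analyticity is not needed.

  That the sequence ends in a constant is a lexicographic descent: the lowest coefficient of \<open>p\<close>
  in \<open>x\<^sub>j\<close> evolves as a derivation-division sequence of its own in one pair of variables less, and
  as soon as it is killed, the division lowers the degree of \<open>p\<close> in \<open>x\<^sub>j, y\<^sub>j\<close>.
\<close>

section \<open>Roots counted with multiplicity\<close>

definition smooth_on :: "real set \<Rightarrow> (real \<Rightarrow> real) \<Rightarrow> bool" where
  "smooth_on S f \<longleftrightarrow> (\<forall>k. \<forall>x\<in>S. (deriv ^^ k) f field_differentiable (at x))"

lemma smooth_on_DERIV:
  "smooth_on S f \<Longrightarrow> x \<in> S \<Longrightarrow> (f has_real_derivative deriv f x) (at x)"
  unfolding smooth_on_def by (metis DERIV_deriv_iff_field_differentiable funpow_0)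

lemma deriv_funpow_Suc: "(deriv ^^ Suc k) f = (deriv ^^ k) (deriv f)"
  by (simp add: funpow_swap1)

lemma smooth_on_deriv: "smooth_on S f \<Longrightarrow> smooth_on S (deriv f)"
  unfolding smooth_on_def by (metis deriv_funpow_Suc)

lemma deriv_cong_open:
  assumes "open S" "\<And>t. t \<in> S \<Longrightarrow> f t = h t" "x \<in> S"
  shows "deriv f x = deriv h x"
  using assms by (intro deriv_cong_ev) (auto simp: eventually_nhds)

lemma deriv_funpow_cong_open:
  assumes "open S" "\<And>t. t \<in> S \<Longrightarrow> f t = h t" "x \<in> S"
  shows "(deriv ^^ k) f x = (deriv ^^ k) h x"
  using assms(3)
proof (induction k arbitrary: x)
  case (Suc k)
  show ?case using deriv_cong_open[OF assms(1) Suc.IH Suc.prems] by simp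
qed (use assms in auto)

text \<open>By induction on \<open>k\<close>, the \<open>k\<close>-th derivative agrees on
  \<open>S\<close> with some member of the family \<open>F\<close>, which is closed under
  differentiation. Openness of \<open>S\<close> lets agreement on \<open>S\<close> pass to
  derivatives.\<close>

lemma smooth_on_coinduct:
  assumes "open S" and "f \<in> F"
    and step: "\<And>f. f \<in> F \<Longrightarrow> \<exists>h\<in>F. \<forall>x\<in>S. (f has_real_derivative h x) (at x)"
  shows "smooth_on S f"
proof -
  have ex: "\<exists>h\<in>F. \<forall>x\<in>S. (deriv ^^ k) f x = h x" for k
  proof (induction k)
    case (Suc k)
    then obtain h where h: "h \<in> F" "\<forall>x\<in>S. (deriv ^^ k) f x = h x" by auto
    from step[OF h(1)] obtain h' where h': "h' \<in> F" "\<forall>x\<in>S. (h has_real_derivative h' x) (at x)"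
      by auto
    have "(deriv ^^ Suc k) f x = h' x" if "x \<in> S" for x
      using deriv_cong_open[OF assms(1) _ that, of "(deriv ^^ k) f" h] h h' that
      by (simp add: DERIV_imp_deriv)
    with h' show ?case by auto
  qed (use assms in auto)
  show ?thesis
    unfolding smooth_on_def
  proof (intro allI ballI)
    fix k x assume x: "x \<in> S"
    obtain h where h: "h \<in> F" "\<forall>x\<in>S. (deriv ^^ k) f x = h x" using ex by blast
    obtain d where "(h has_real_derivative d) (at x)" using step[OF h(1)] x by blast
    then have "((deriv ^^ k) f has_real_derivative d) (at x)"
      using has_field_derivative_transform_within_open[of h d x S "(deriv ^^ k) f"] assms(1) h x
      by auto
    then show "(deriv ^^ k) f field_differentiable (at x)"
      by (auto simp: field_differentiable_def)
  qed
qed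

lemma smooth_on_I:
  assumes "open S" "\<And>x. x \<in> S \<Longrightarrow> (f has_real_derivative h x) (at x)" "smooth_on S h"
  shows "smooth_on S f"
  by (rule smooth_on_coinduct[where F = "insert f {h. smooth_on S h}"])
     (use assms smooth_on_DERIV smooth_on_deriv in blast)+

text \<open>Smoothness of products is not directly coinductive, since the derivative of a product is a
  sum of products.\<close>

inductive_set smooth_algebra :: "real set \<Rightarrow> (real \<Rightarrow> real) set" for S where
  base: "smooth_on S f \<Longrightarrow> f \<in> smooth_algebra S"
| add: "f \<in> smooth_algebra S \<Longrightarrow> h \<in> smooth_algebra S \<Longrightarrow> (\<lambda>x. f x + h x) \<in> smooth_algebra S"
| mult: "f \<in> smooth_algebra S \<Longrightarrow> h \<in> smooth_algebra S \<Longrightarrow> (\<lambda>x. f x * h x) \<in> smooth_algebra S"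

lemma smooth_algebra_smooth:
  assumes "open S" "f \<in> smooth_algebra S"
  shows "smooth_on S f"
  using assms
proof (rule smooth_on_coinduct)
  fix f assume "f \<in> smooth_algebra S"
  then show "\<exists>h\<in>smooth_algebra S. \<forall>x\<in>S. (f has_real_derivative h x) (at x)"
  proof induction
    case (base f)
    then show ?case using smooth_on_DERIV smooth_on_deriv smooth_algebra.base by blast
  next
    case (add f h)
    then obtain f' h' where "f' \<in> smooth_algebra S" "\<forall>x\<in>S. (f has_real_derivative f' x) (at x)"
      "h' \<in> smooth_algebra S" "\<forall>x\<in>S. (h has_real_derivative h' x) (at x)" by blast
    then show ?case
      by (intro bexI[of _ "\<lambda>x. f' x + h' x"]) (auto intro: smooth_algebra.intros derivative_intros)
  next
    case (mult f h)
    then obtain f' h' where "f' \<in> smooth_algebra S" "\<forall>x\<in>S. (f has_real_derivative f' x) (at x)"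
      "h' \<in> smooth_algebra S" "\<forall>x\<in>S. (h has_real_derivative h' x) (at x)" by blast
    with mult show ?case
      by (intro bexI[of _ "\<lambda>x. f' x * h x + h' x * f x"])
         (auto intro: smooth_algebra.intros DERIV_mult)
  qed
qed

lemma smooth_on_mult:
  "open S \<Longrightarrow> smooth_on S f \<Longrightarrow> smooth_on S h \<Longrightarrow> smooth_on S (\<lambda>x. f x * h x)"
  by (rule smooth_algebra_smooth[OF _ smooth_algebra.mult[OF smooth_algebra.base smooth_algebra.base]])

section \<open>Iterated derivatives, orders of vanishing and counting of zeros\<close>

lemma deriv_funpow_add:
  assumes "open S" "smooth_on S f" "smooth_on S h" "x \<in> S"
  shows "(deriv ^^ k) (\<lambda>t. f t + h t) x = (deriv ^^ k) f x + (deriv ^^ k) h x"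
  using assms(2-)
proof (induction k arbitrary: f h)
  case (Suc k)
  have "(deriv ^^ Suc k) (\<lambda>t. f t + h t) x = (deriv ^^ k) (\<lambda>t. deriv f t + deriv h t) x"
    unfolding deriv_funpow_Suc
    by (rule deriv_funpow_cong_open[OF assms(1) _ assms(4)], rule DERIV_imp_deriv)
       (intro DERIV_add smooth_on_DERIV[OF Suc.prems(1)] smooth_on_DERIV[OF Suc.prems(2)])
  then show ?case
    using Suc.IH[of "deriv f" "deriv h"] Suc.prems by (simp add: smooth_on_deriv funpow_swap1)
qed auto

text \<open>Of the terms in Leibniz's rule only the one with every derivative on \<open>h\<close>
  survives. Binomial coefficients are avoided by differentiating once and using the induction
  hypothesis for both \<open>deriv u * h\<close> and \<open>u * deriv h\<close>; the first
  contributes 0.\<close>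

lemma deriv_funpow_mult_vanishing:
  assumes "open S" "smooth_on S u" "smooth_on S h" "x \<in> S" "\<forall>i<k. (deriv ^^ i) h x = 0"
  shows "(deriv ^^ k) (\<lambda>t. u t * h t) x = u x * (deriv ^^ k) h x"
  using assms(2-)
proof (induction k arbitrary: u h)
  case (Suc k)
  note [simp] = smooth_on_deriv smooth_on_mult assms(1)
  have "(deriv ^^ Suc k) (\<lambda>t. u t * h t) x
      = (deriv ^^ k) (\<lambda>t. deriv u t * h t + u t * deriv h t) x"
    unfolding deriv_funpow_Suc
  proof (rule deriv_funpow_cong_open[OF assms(1) _ assms(4)], rule DERIV_imp_deriv)
    fix t assume "t \<in> S"
    then show "((\<lambda>t. u t * h t) has_real_derivative deriv u t * h t + u t * deriv h t) (at t)"
      using smooth_on_DERIV Suc.prems by (auto intro!: derivative_eq_intros)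
  qed
  also have "\<dots> = (deriv ^^ k) (\<lambda>t. deriv u t * h t) x + (deriv ^^ k) (\<lambda>t. u t * deriv h t) x"
    using Suc.prems by (intro deriv_funpow_add[OF assms(1)]) auto
  also have "\<dots> = deriv u x * (deriv ^^ k) h x + u x * (deriv ^^ k) (deriv h) x"
  proof -
    have "(deriv ^^ i) (deriv h) x = 0" if "i < k" for i
      using Suc.prems(4) that by (metis Suc_mono deriv_funpow_Suc)
    then show ?thesis
      using Suc.IH[of "deriv u" h] Suc.IH[of u "deriv h"] Suc.prems by simp
  qed
  also have "\<dots> = u x * (deriv ^^ Suc k) h x"
    unfolding deriv_funpow_Suc using Suc.prems by simp
  finally show ?case .
qed auto

text \<open>Up to the order of \<open>h\<close>, the derivatives of \<open>f\<close> at
  \<open>x\<close> are those of \<open>h\<close> times \<open>u x\<close>, so the first nonzero one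
  has the same index. The existence of such an index is carried along because the
  \<open>LEAST\<close> in \<open>root_mult\<close> is meaningless without it.\<close>

lemma root_mult_unit:
  assumes "open S" "smooth_on S u" "smooth_on S h" "x \<in> S" "u x \<noteq> 0"
    and f: "\<And>t. t \<in> S \<Longrightarrow> f t = u t * h t" and ex: "\<exists>k. (deriv ^^ k) h x \<noteq> 0"
  shows "root_mult f x = root_mult h x \<and> (\<exists>k. (deriv ^^ k) f x \<noteq> 0)"
proof -
  define k where "k = root_mult h x"
  have k: "(deriv ^^ k) h x \<noteq> 0"
    using LeastI_ex[OF ex] by (simp add: k_def root_mult_def)
  have lt: "\<forall>i<k. (deriv ^^ i) h x = 0"
    using not_less_Least[of _ "\<lambda>k. (deriv ^^ k) h x \<noteq> 0"] by (auto simp: k_def root_mult_def)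
  have eq: "(deriv ^^ i) f x = u x * (deriv ^^ i) h x" if "i \<le> k" for i
    using deriv_funpow_cong_open[OF assms(1) f assms(4), of _ i]
      deriv_funpow_mult_vanishing[OF assms(1-4), of i] lt that by auto
  have "root_mult f x = k"
    unfolding root_mult_def
  proof (rule Least_equality)
    show "(deriv ^^ k) f x \<noteq> 0" using eq k assms by simp
    show "k \<le> i" if "(deriv ^^ i) f x \<noteq> 0" for i
      using eq[of i] lt that by (metis linorder_not_le mult_zero_right nat_less_le)
  qed
  moreover have "(deriv ^^ k) f x \<noteq> 0" using eq[of k] k assms(5) by simp
  ultimately show ?thesis unfolding k_def by blast
qed

lemma root_mult_deriv:
  assumes "f x = 0" "\<exists>k. (deriv ^^ k) (deriv f) x \<noteq> 0"
  shows "root_mult f x = Suc (root_mult (deriv f) x)"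
proof -
  obtain k where "(deriv ^^ Suc k) f x \<noteq> 0" using assms(2) unfolding deriv_funpow_Suc by blast
  then have "(LEAST k. (deriv ^^ k) f x \<noteq> 0) = Suc (LEAST k. (deriv ^^ Suc k) f x \<noteq> 0)"
    by (rule Least_Suc) (use assms in simp)
  then show ?thesis unfolding root_mult_def deriv_funpow_Suc .
qed

text \<open>The alternative replaces the identity theorem for analytic functions. Finite order is
  demanded at every point of \<open>S\<close>, so that it passes from a derivative to its
  primitive.\<close>

definition zeros_bound :: "(real \<Rightarrow> real) \<Rightarrow> real set \<Rightarrow> nat \<Rightarrow> bool" where
  "zeros_bound f S N \<longleftrightarrow> (\<forall>x\<in>S. f x = 0) \<or>
     (finite {x\<in>S. f x = 0} \<and> (\<forall>x\<in>S. \<exists>k. (deriv ^^ k) f x \<noteq> 0) \<and>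
      (\<Sum>x | x \<in> S \<and> f x = 0. root_mult f x) \<le> N)"

text \<open>If \<open>f\<close> vanishes identically, its zero set is the open set \<open>S\<close>,
  which has no isolated points, and the sum is empty. Otherwise the isolated roots are among the
  finitely many zeros.\<close>

lemma zeros_bound_isolated:
  assumes "open S" "zeros_bound f S N"
  shows "finite (isolated_roots f S) \<and> (\<Sum>x\<in>isolated_roots f S. root_mult f x) \<le> N"
proof (cases "\<forall>x\<in>S. f x = 0")
  case True
  then have "{t\<in>S. f t = 0} = S" by auto
  moreover have "\<not> x isolated_in S" for x
  proof
    assume "x isolated_in S"
    then obtain T where T: "open T" "T \<inter> S = {x}" "x \<in> S" unfolding isolated_in_def by auto
    then have "open {x}" using assms(1) by (metis open_Int)
    then show False by (simp add: not_open_singleton)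
  qed
  ultimately show ?thesis by (simp add: isolated_roots_def)
next
  case False
  then have fin: "finite {x\<in>S. f x = 0}" and le: "(\<Sum>x | x \<in> S \<and> f x = 0. root_mult f x) \<le> N"
    using assms(2) by (auto simp: zeros_bound_def)
  have sub: "isolated_roots f S \<subseteq> {x\<in>S. f x = 0}"
    by (auto simp: isolated_roots_def isolated_in_def)
  show ?thesis
    using finite_subset[OF sub fin] sum_mono2[OF fin sub, of "root_mult f"] le by auto
qed

lemma zeros_bound_const: "zeros_bound (\<lambda>t. c) T N"
proof (cases "c = 0")
  case False
  then have "\<forall>x\<in>T. (deriv ^^ 0) (\<lambda>t. c) x \<noteq> 0" by simp
  then show ?thesis unfolding zeros_bound_def using False by (auto intro: exI[of _ 0])
qed (simp add: zeros_bound_def)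

text \<open>Transfers the bound across the division by a regularization monomial, which is zero-free
  as a function.\<close>

lemma zeros_bound_unit:
  assumes "open S" "smooth_on S u" "smooth_on S h" "\<And>x. x \<in> S \<Longrightarrow> u x \<noteq> 0"
    and f: "\<And>x. x \<in> S \<Longrightarrow> f x = u x * h x" and "zeros_bound h S N"
  shows "zeros_bound f S N"
proof (cases "\<forall>x\<in>S. h x = 0")
  case True
  then show ?thesis using f by (simp add: zeros_bound_def)
next
  case False
  have Z: "{x\<in>S. f x = 0} = {x\<in>S. h x = 0}" using f assms(4) by auto
  have r: "root_mult f x = root_mult h x \<and> (\<exists>k. (deriv ^^ k) f x \<noteq> 0)" if "x \<in> S" for x
    using root_mult_unit[OF assms(1-3) that assms(4)[OF that], of f] f assms(6) False that
    by (auto simp: zeros_bound_def)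
  then have "(\<Sum>x | x \<in> S \<and> f x = 0. root_mult f x) = (\<Sum>x | x \<in> S \<and> h x = 0. root_mult h x)"
    unfolding Z by (intro sum.cong) auto
  moreover have "finite {x\<in>S. h x = 0}" "(\<Sum>x | x \<in> S \<and> h x = 0. root_mult h x) \<le> N"
    using assms(6) False by (auto simp: zeros_bound_def)
  ultimately show ?thesis using r Z unfolding zeros_bound_def by metis
qed

text \<open>Every element of \<open>A\<close> except the largest is sent to a point of
  \<open>B\<close> between it and its successor. Such a point is outside \<open>A\<close>, and these
  points are distinct. Counting in \<open>B - A\<close> leaves the common points of \<open>A\<close>
  and \<open>B\<close> free to account for multiple zeros.\<close>

lemma card_interlaced:
  fixes A B :: "'a::linorder set"
  assumes "finite A" "finite B" and between: "\<And>a b. a \<in> A \<Longrightarrow> b \<in> A \<Longrightarrow> a < b \<Longrightarrow> \<exists>c\<in>B. a < c \<and> c < b"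
  shows "card A \<le> card (B - A) + 1"
proof (cases "A = {}")
  case False
  \<comment> \<open>\<open>nx a\<close> is the successor of \<open>a\<close> in
    \<open>A\<close>.\<close>
  define nx where "nx a = Min {b\<in>A. a < b}" for a
  have nx: "nx a \<in> A" "a < nx a" "\<And>b. b \<in> A \<Longrightarrow> a < b \<Longrightarrow> nx a \<le> b"
    if "a \<in> A - {Max A}" for a
  proof -
    have "a < Max A" using that assms(1) by (metis DiffE Max_ge insertI1 order_le_imp_less_or_eq)
    then have "{b\<in>A. a < b} \<noteq> {}" using Max_in[OF assms(1) False] by auto
    then have "Min {b\<in>A. a < b} \<in> {b\<in>A. a < b}" using assms(1) by (intro Min_in) auto
    then show "nx a \<in> A" "a < nx a" by (auto simp: nx_def)
    show "nx a \<le> b" if "b \<in> A" "a < b" for b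
      unfolding nx_def using that assms(1) by (intro Min_le) auto
  qed
  have "\<forall>a\<in>A - {Max A}. \<exists>c\<in>B. a < c \<and> c < nx a" using nx between by blast
  then obtain c where c: "\<And>a. a \<in> A - {Max A} \<Longrightarrow> c a \<in> B \<and> a < c a \<and> c a < nx a" by metis
  have "c ` (A - {Max A}) \<subseteq> B - A" using c nx(3) by (fastforce simp: not_le)
  moreover have "inj_on c (A - {Max A})"
  proof (rule linorder_inj_onI)
    fix a a' assume "a < a'" "a \<in> A - {Max A}" "a' \<in> A - {Max A}"
    then have "c a < c a'" using c[of a] c[of a'] nx(3)[of a a'] by force
    then show "c a \<noteq> c a'" by simp
  qed auto
  ultimately have "card (A - {Max A}) \<le> card (B - A)"
    using assms(2) by (metis card_inj_on_le finite_Diff)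
  then show ?thesis using assms(1) by (simp add: card_Diff_singleton_if split: if_splits)
qed simp

text \<open>A zero of \<open>f\<close> of order \<open>m\<close> is a zero of \<open>deriv f\<close>
  of order \<open>m - 1\<close>. Thus the orders for \<open>f\<close> sum to the number of zeros of
  \<open>f\<close> plus the orders of \<open>deriv f\<close> at these points. By Rolle that number
  exceeds by at most one the number of zeros of \<open>deriv f\<close> at which \<open>f\<close>
  does not vanish.\<close>

lemma zeros_bound_Rolle:
  assumes S: "is_interval S" "open S" and "smooth_on S f" and zb: "zeros_bound (deriv f) S N"
  shows "zeros_bound f S (Suc N)"
proof (cases "\<forall>x\<in>S. deriv f x = 0")
  case True
  \<comment> \<open>With vanishing derivative on an interval, \<open>f\<close> is constant:
    identically zero or without zeros.\<close>
  have "\<exists>c. \<forall>x\<in>S. f x = c"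
  proof (rule has_field_derivative_zero_constant)
    show "convex S" using S is_interval_convex by blast
    show "(f has_field_derivative 0) (at x within S)" if "x \<in> S" for x
      using smooth_on_DERIV[OF assms(3) that] True that
      by (metis has_field_derivative_at_within)
  qed
  then obtain c where c: "\<forall>x\<in>S. f x = c" by blast
  show ?thesis
  proof (cases "c = 0")
    case False
    then have "{x\<in>S. f x = 0} = {}" "\<forall>x\<in>S. (deriv ^^ 0) f x \<noteq> 0" using c by auto
    then show ?thesis unfolding zeros_bound_def by (metis finite.emptyI sum.empty zero_le)
  qed (use c in \<open>simp add: zeros_bound_def\<close>)
next
  case False
  define Z where "Z = {x\<in>S. f x = 0}"
  define Z' where "Z' = {x\<in>S. deriv f x = 0}"
  have Z': "finite Z'" and ex: "\<And>x. x \<in> S \<Longrightarrow> \<exists>k. (deriv ^^ k) (deriv f) x \<noteq> 0"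
    and le: "(\<Sum>x\<in>Z'. root_mult (deriv f) x) \<le> N"
    using zb False by (auto simp: zeros_bound_def Z'_def)
  have rolle: "\<exists>c\<in>Z'. a < c \<and> c < b" if "a \<in> Z" "b \<in> Z" "a < b" for a b
  proof -
    have sub: "t \<in> S" if "a \<le> t" "t \<le> b" for t
      using S(1) that \<open>a \<in> Z\<close> \<open>b \<in> Z\<close> unfolding is_interval_1 Z_def by blast
    have D: "(f has_real_derivative deriv f t) (at t)" if "a \<le> t" "t \<le> b" for t
      using smooth_on_DERIV[OF assms(3) sub] that .
    have "\<exists>c>a. c < b \<and> (*) (deriv f c) = (\<lambda>v. 0)"
    proof (rule Rolle_deriv)
      show "f a = f b" using that by (simp add: Z_def)
      show "continuous_on {a..b} f"
        by (rule continuous_at_imp_continuous_on) (metis D DERIV_isCont atLeastAtMost_iff)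
      show "(f has_derivative (*) (deriv f t)) (at t)" if "a < t" "t < b" for t
        using D[of t] that by (simp add: has_field_derivative_def)
    qed fact
    then obtain c where c: "a < c" "c < b" "deriv f c = 0" by (metis mult.right_neutral)
    then show ?thesis using sub[of c] by (intro bexI[of _ c]) (auto simp: Z'_def)
  qed
  \<comment> \<open>Finiteness of \<open>Z\<close> is not known yet, so the interlacing bound is
    first applied to its finite subsets.\<close>
  have "card F \<le> card Z' + 1" if "F \<subseteq> Z" "finite F" for F
    using card_interlaced[OF that(2) Z', OF rolle] that card_mono[OF Z', of "Z' - F"] by fastforce
  then have fin: "finite Z" using finite_if_finite_subsets_card_bdd[of Z "card Z' + 1"] by blast
  have "(\<Sum>x\<in>Z. root_mult f x) = (\<Sum>x\<in>Z. Suc (root_mult (deriv f) x))"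
    using root_mult_deriv[OF _ ex] by (intro sum.cong) (auto simp: Z_def)
  also have "\<dots> = card Z + (\<Sum>x\<in>Z. root_mult (deriv f) x)" by (simp add: sum_Suc)
  also have "(\<Sum>x\<in>Z. root_mult (deriv f) x) = (\<Sum>x\<in>Z \<inter> Z'. root_mult (deriv f) x)"
  proof (rule sum.mono_neutral_right)
    show "\<forall>x\<in>Z - Z \<inter> Z'. root_mult (deriv f) x = 0"
      by (auto simp: Z_def Z'_def root_mult_def intro!: Least_equality)
  qed (use fin in auto)
  also have "card Z \<le> card (Z' - Z) + 1" using card_interlaced[OF fin Z' rolle] .
  \<comment> \<open>Each zero of \<open>deriv f\<close> has order at least 1, so points can be
    exchanged for orders.\<close>
  also have "card (Z' - Z) \<le> (\<Sum>x\<in>Z' - Z. root_mult (deriv f) x)"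
  proof -
    have "1 \<le> root_mult (deriv f) x" if "x \<in> Z' - Z" for x
    proof -
      have "(deriv ^^ root_mult (deriv f) x) (deriv f) x \<noteq> 0"
        unfolding root_mult_def by (rule LeastI_ex) (use ex that in \<open>auto simp: Z'_def\<close>)
      then show ?thesis using that by (cases "root_mult (deriv f) x") (auto simp: Z'_def)
    qed
    then show ?thesis using sum_mono[of "Z' - Z" "\<lambda>_. 1" "root_mult (deriv f)"] by simp
  qed
  also have "(\<Sum>x\<in>Z' - Z. root_mult (deriv f) x) + 1 + (\<Sum>x\<in>Z \<inter> Z'. root_mult (deriv f) x)
      = (\<Sum>x\<in>Z'. root_mult (deriv f) x) + 1"
    using sum.Int_Diff[OF Z', of "root_mult (deriv f)" Z] by (simp add: Int_commute)
  finally have "(\<Sum>x\<in>Z. root_mult f x) \<le> Suc N" using le by simp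
  moreover have "\<exists>k. (deriv ^^ k) f x \<noteq> 0" if "x \<in> S" for x
    using ex[OF that] deriv_funpow_Suc by metis
  ultimately show ?thesis using fin by (auto simp: zeros_bound_def Z_def)
qed


section \<open>Termination of the derivation-division sequence\<close>

abbreviation "lk \<equiv> Poly_Mapping.lookup"
abbreviation "sg \<equiv> Poly_Mapping.single"
abbreviation "ks \<equiv> Poly_Mapping.keys"

definition dmon :: "nat \<Rightarrow> lmon" where
  "dmon j = sg (X j) 1 + (\<Sum>i\<in>{1..<j}. sg (X i) 1 - sg (Y i) 1)"

lemma lmonom_sum: "lmonom (sum f A) = (\<Prod>i\<in>A. lmonom (f i))"
  by (induction A rule: infinite_finite_induct) (simp_all add: lmonom_0 lmonom_add)

lemma deriv_var_dmon: "deriv_var v = sg (dmon (index v)) (Delta (index v))"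
proof -
  have "var (X i) * inv_var (Y i) = lmonom (sg (X i) 1 - sg (Y i) 1)" for i
    by (simp add: var_def inv_var_def single_uminus flip: lmonom_add)
  then have "deriv_var v = const (Delta (index v)) * lmonom (dmon (index v))"
    by (simp add: deriv_var_def dmon_def var_def lmonom_add lmonom_sum mult.assoc)
  then show ?thesis by (simp add: const_def lmonom_def mult_single)
qed

lemma lookup_dmon:
  "lk (dmon j) (X i) = (if i = j \<or> 1 \<le> i \<and> i < j then 1 else 0)"
  "lk (dmon j) (Y i) = (if 1 \<le> i \<and> i < j then - 1 else 0)"
  by (auto simp: dmon_def lookup_add lookup_sum lookup_minus lookup_single when_def sum_negf)

text \<open>In each monomial one factor \<open>v\<close> is replaced by the monomial of its
  derivative. Cancellation may occur, so only this inclusion of supports holds in general.\<close>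

lemma keys_ld:
  assumes "e' \<in> ks (ld p)"
  obtains e v where "e \<in> ks p" "v \<in> ks e" "e' = e - sg v 1 + dmon (index v)"
proof -
  have "e' \<in> (\<Union>e\<in>ks p. \<Union>v\<in>ks e. ks (sg (e - sg v 1) (of_int (lk e v) * lk p e) * deriv_var v))"
    using assms keys_sum unfolding ld_def by (smt (verit) UN_iff subsetD)
  then obtain e v where "e \<in> ks p" "v \<in> ks e"
    "e' \<in> ks (sg (e - sg v 1) (of_int (lk e v) * lk p e) * deriv_var v)" by auto
  moreover from this have "e' = e - sg v 1 + dmon (index v)"
    by (auto simp: deriv_var_dmon mult_single split: if_splits)
  ultimately show ?thesis using that by blast
qed

lemma lookup_mult_lmonom: "lk (p * lmonom d) e = lk p (e - d)"
proof -
  have "p * lmonom d = (\<Sum>e\<in>ks p. sg (e + d) (lk p e))"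
    by (subst laurent_expand[of p]) (simp add: sum_distrib_right lmonom_def mult_single)
  then have "lk (p * lmonom d) e = (\<Sum>e'\<in>ks p. if e' = e - d then lk p e' else 0)"
    by (auto simp: lookup_sum lookup_single when_def algebra_simps intro!: sum.cong)
  then show ?thesis by (auto simp: sum.delta in_keys_iff)
qed

lemma in_keys_mult_lmonom: "e \<in> ks (p * lmonom d) \<longleftrightarrow> e - d \<in> ks p"
  by (simp add: in_keys_iff lookup_mult_lmonom)

lemma mult_lmonom_eq_0_iff [simp]: "p * lmonom d = 0 \<longleftrightarrow> p = 0"
proof
  assume "p * lmonom d = 0"
  then have "p * lmonom d * lmonom (- d) = 0" by simp
  then show "p = 0" by (simp add: mult.assoc lmonom_0 flip: lmonom_add)
qed simp

lemma mdeg_add: "mdeg (e + e') i = mdeg e i + mdeg e' i"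
  and mdeg_diff: "mdeg (e - e') i = mdeg e i - mdeg e' i"
  by (simp_all add: mdeg_def lookup_add lookup_minus)

text \<open>The quotients of \<open>X i\<close> by \<open>Y i\<close> have degree 0, and
  \<open>X j\<close> and \<open>Y j\<close> have equal degree. Hence the derivation preserves
  degrees.\<close>

lemma mdeg_dmon: "mdeg (dmon (index v)) = mdeg (sg v 1)"
  by (cases v) (auto simp: mdeg_def lookup_dmon lookup_single when_def)

lemma homogeneousI: "p \<noteq> 0 \<Longrightarrow> (\<And>e. e \<in> ks p \<Longrightarrow> mdeg e = d) \<Longrightarrow> homogeneous p"
  by (auto simp: homogeneous_def)

lemma pdegI:
  assumes "p \<noteq> 0" "\<And>e. e \<in> ks p \<Longrightarrow> mdeg e = d"
  shows "pdeg p = d"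
proof -
  obtain e where "e \<in> ks p" using assms(1) by (metis keys_eq_empty ex_in_conv)
  then show ?thesis using pdeg_eq[OF homogeneousI, OF assms] assms(2) by simp
qed

lemma homogeneous_ld:
  assumes "homogeneous p" "ld p \<noteq> 0"
  shows "homogeneous (ld p)" "pdeg (ld p) = pdeg p"
proof -
  have "mdeg e = pdeg p" if "e \<in> ks (ld p)" for e
    using that by (rule keys_ld) (auto simp: pdeg_eq[OF assms(1)] mdeg_add mdeg_diff mdeg_dmon fun_eq_iff)
  then show "homogeneous (ld p)" "pdeg (ld p) = pdeg p"
    using homogeneousI pdegI assms(2) by blast+
qed

lemma homogeneous_mult_lmonom:
  assumes "homogeneous p"
  shows "homogeneous (p * lmonom d)" "pdeg (p * lmonom d) i = pdeg p i + mdeg d i"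
proof -
  have "mdeg e = (\<lambda>i. pdeg p i + mdeg d i)" if "e \<in> ks (p * lmonom d)" for e
    using that pdeg_eq[OF assms] by (auto simp: in_keys_mult_lmonom mdeg_diff fun_eq_iff)
  moreover have "p * lmonom d \<noteq> 0" using assms by (simp add: homogeneous_def)
  ultimately show "homogeneous (p * lmonom d)" "pdeg (p * lmonom d) i = pdeg p i + mdeg d i"
    using homogeneousI pdegI by (blast, metis)
qed

section \<open>Rings of Laurent polynomials in prescribed variables\<close>

definition laurent_on :: "lvar set \<Rightarrow> laurent set" where
  "laurent_on V = {p. \<forall>e\<in>ks p. ks e \<subseteq> V}"

definition vars :: "nat \<Rightarrow> lvar set" where
  "vars j = {v. 1 \<le> index v \<and> index v \<le> j}"

abbreviation laurent_ring :: "nat \<Rightarrow> laurent set" where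
  "laurent_ring j \<equiv> laurent_on (vars j)"

lemma keys_subset_iff: "ks e \<subseteq> V \<longleftrightarrow> (\<forall>v. v \<notin> V \<longrightarrow> lk e v = 0)"
  by (auto simp: in_keys_iff)

lemma laurent_ringD:
  "p \<in> laurent_ring j \<Longrightarrow> e \<in> ks p \<Longrightarrow> v \<in> ks e \<Longrightarrow> 1 \<le> index v \<and> index v \<le> j"
  by (auto simp: laurent_on_def vars_def)

lemma laurent_on_mono: "V \<subseteq> W \<Longrightarrow> p \<in> laurent_on V \<Longrightarrow> p \<in> laurent_on W"
  by (auto simp: laurent_on_def)

lemma laurent_on_ld:
  assumes "p \<in> laurent_on V" and V: "\<And>v. v \<in> V \<Longrightarrow> ks (dmon (index v)) \<subseteq> V"
  shows "ld p \<in> laurent_on V"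
  unfolding laurent_on_def
proof (intro CollectI ballI)
  fix e' assume "e' \<in> ks (ld p)"
  then obtain e v where e: "e \<in> ks p" "v \<in> ks e" "e' = e - sg v 1 + dmon (index v)" by (rule keys_ld)
  have "v \<in> V" "ks e \<subseteq> V" using assms(1) e by (auto simp: laurent_on_def)
  with V[of v] show "ks e' \<subseteq> V"
    unfolding keys_subset_iff e(3) by (auto simp: lookup_add lookup_minus lookup_single when_def)
qed

lemma laurent_ring_ld:
  assumes "p \<in> laurent_ring j"
  shows "ld p \<in> laurent_ring j"
proof (rule laurent_on_ld[OF assms])
  fix v assume v: "v \<in> vars j"
  show "ks (dmon (index v)) \<subseteq> vars j"
    unfolding keys_subset_iff
  proof (intro allI impI)
    fix w assume "w \<notin> vars j"
    then show "lk (dmon (index v)) w = 0"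
      using v by (cases w) (auto simp: lookup_dmon vars_def)
  qed
qed

lemma laurent_on_mult:
  assumes "p \<in> laurent_on V" "q \<in> laurent_on V"
  shows "p * q \<in> laurent_on V"
proof -
  have "ks e \<subseteq> V" if "e \<in> ks (p * q)" for e
  proof -
    obtain e1 e2 where "e1 \<in> ks p" "e2 \<in> ks q" "e = e1 + e2"
      using \<open>e \<in> ks (p * q)\<close> keys_mult by blast
    then show ?thesis
      using assms Poly_Mapping.keys_add[of e1 e2] unfolding laurent_on_def by blast
  qed
  then show ?thesis by (auto simp: laurent_on_def)
qed

lemma laurent_on_lmonom: "ks e \<subseteq> V \<Longrightarrow> lmonom e \<in> laurent_on V"
  by (simp add: laurent_on_def lmonom_def)

lemma keys_reg: "ks (reg j p) \<subseteq> vars j"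
proof (induction j arbitrary: p)
  case (Suc j)
  then show ?case
    unfolding keys_subset_iff reg.simps lookup_add
    by (auto simp: vars_def lookup_single when_def)
qed simp

section \<open>Coefficients with respect to one pair of variables\<close>

lemma lookup_xcoeff:
  "lk (xcoeff j p i) e =
    (if lk e (X j) = 0 then lk p (e + sg (X j) i + sg (Y j) (pdeg p j - i)) else 0)"
proof -
  let ?s = "sg (X j) i + sg (Y j) (pdeg p j - i)"
  have "lk (xcoeff j p i) e = (\<Sum>e'\<in>{e'\<in>ks p. lk e' (X j) = i}. if e' = e + ?s then lk p e' else 0)"
    unfolding xcoeff_def lookup_sum
    by (intro sum.cong refl) (auto simp: lookup_single when_def algebra_simps)
  also have "\<dots> = (if lk e (X j) = 0 then lk p (e + ?s) else 0)"
    by (auto simp: sum.delta in_keys_iff lookup_add lookup_single)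
  finally show ?thesis by (simp add: add.assoc)
qed

lemma keys_xcoeff:
  assumes "e \<in> ks (xcoeff j p i)"
  shows "lk e (X j) = 0" "e + sg (X j) i + sg (Y j) (pdeg p j - i) \<in> ks p"
  using assms by (auto simp: in_keys_iff lookup_xcoeff split: if_splits)

lemma homogeneous_xcoeff:
  assumes "homogeneous p" "xcoeff j p i \<noteq> 0"
  shows "homogeneous (xcoeff j p i)"
proof (rule homogeneousI[OF assms(2)])
  fix e assume "e \<in> ks (xcoeff j p i)"
  then have *: "pdeg p = mdeg (e + sg (X j) i + sg (Y j) (pdeg p j - i))"
    using pdeg_eq[OF assms(1)] keys_xcoeff by blast
  show "mdeg e = (\<lambda>k. pdeg p k - mdeg (sg (X j) i) k - mdeg (sg (Y j) (pdeg p j - i)) k)"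
  proof
    fix k
    show "mdeg e k = pdeg p k - mdeg (sg (X j) i) k - mdeg (sg (Y j) (pdeg p j - i)) k"
      using fun_cong[OF *, of k] unfolding mdeg_add by linarith
  qed
qed

text \<open>By homogeneity a monomial with exponent \<open>i\<close> in \<open>X (Suc j)\<close> has
  exponent \<open>pdeg p (Suc j) - i\<close> in \<open>Y (Suc j)\<close>, exactly what
  \<open>xcoeff\<close> divides out. So neither variable of the last pair is left.\<close>

lemma xcoeff_laurent_ring:
  assumes "homogeneous p" "p \<in> laurent_ring (Suc j)"
  shows "xcoeff (Suc j) p i \<in> laurent_ring j"
  unfolding laurent_on_def
proof (intro CollectI ballI)
  fix e assume "e \<in> ks (xcoeff (Suc j) p i)"
  note e = keys_xcoeff[OF this]
  let ?e = "e + sg (X (Suc j)) i + sg (Y (Suc j)) (pdeg p (Suc j) - i)"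
  have "lk e (Y (Suc j)) = 0"
    using fun_cong[OF pdeg_eq[OF assms(1) e(2)], of "Suc j"] e(1)
    by (simp add: mdeg_def lookup_add lookup_single)
  moreover have "ks ?e \<subseteq> vars (Suc j)" using assms(2) e(2) by (auto simp: laurent_on_def)
  ultimately have *: "\<forall>v. v \<notin> vars (Suc j) \<longrightarrow> lk ?e v = 0" "lk e (Y (Suc j)) = 0"
      "lk e (X (Suc j)) = 0"
    using e(1) unfolding keys_subset_iff by blast+
  show "ks e \<subseteq> vars j"
    unfolding keys_subset_iff
  proof (intro allI impI)
    fix v assume v: "v \<notin> vars j"
    show "lk e v = 0"
    proof (cases "v = X (Suc j) \<or> v = Y (Suc j)")
      case False
      then have "v \<notin> vars (Suc j)" using v by (cases v) (auto simp: vars_def le_Suc_eq)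
      then show ?thesis using * False by (auto simp: lookup_add lookup_single when_def)
    qed (use * in auto)
  qed
qed

lemma xcoeff_mult_lmonom:
  assumes "homogeneous p"
  shows "xcoeff j (p * lmonom d) i = xcoeff j p (i - lk d (X j)) *
    lmonom (d - sg (X j) (lk d (X j)) - sg (Y j) (lk d (Y j)))"
proof (rule poly_mapping_eqI)
  fix e
  have "e + sg (X j) i + sg (Y j) (pdeg p j + mdeg d j - i) - d =
      e - (d - sg (X j) (lk d (X j)) - sg (Y j) (lk d (Y j))) + sg (X j) (i - lk d (X j))
      + sg (Y j) (pdeg p j - (i - lk d (X j)))"
    by (rule poly_mapping_eqI) (auto simp: lookup_add lookup_minus lookup_single when_def mdeg_def)
  note E = this
  show "lk (xcoeff j (p * lmonom d) i) e = lk (xcoeff j p (i - lk d (X j)) *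
      lmonom (d - sg (X j) (lk d (X j)) - sg (Y j) (lk d (Y j)))) e"
    unfolding lookup_xcoeff lookup_mult_lmonom homogeneous_mult_lmonom(2)[OF assms] E
    by (simp add: lookup_minus lookup_single)
qed

lemma xmin_xmax:
  assumes "homogeneous p" "e \<in> ks p"
  shows "xmin j p \<le> lk e (X j)" "lk e (X j) \<le> xmax j p"
  unfolding xmin_def xmax_def xcoeff_nonzero[OF assms(1)] using assms(2) by auto

lemma xmin_xmax_in:
  assumes "homogeneous p"
  shows "xcoeff j p (xmin j p) \<noteq> 0" "xcoeff j p (xmax j p) \<noteq> 0"
proof -
  have "{i. xcoeff j p i \<noteq> 0} \<noteq> {}" "finite {i. xcoeff j p i \<noteq> 0}"
    unfolding xcoeff_nonzero[OF assms] using assms by (auto simp: homogeneous_def)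
  then show "xcoeff j p (xmin j p) \<noteq> 0" "xcoeff j p (xmax j p) \<noteq> 0"
    using Min_in Max_in unfolding xmin_def xmax_def by blast+
qed

section \<open>Lowest coefficients under derivation and division\<close>

definition nonneg_at :: "nat \<Rightarrow> laurent \<Rightarrow> bool" where
  "nonneg_at j p \<longleftrightarrow> (\<forall>e\<in>ks p. 0 \<le> lk e (X j) \<and> 0 \<le> lk e (Y j))"

text \<open>A factor \<open>X j\<close> or \<open>Y j\<close> is removed only where its exponent is
  positive, and what replaces it contains \<open>X j\<close> once and \<open>Y j\<close> not at all.
  Derivatives of variables of smaller index involve neither.\<close>

lemma nonneg_at_ld:
  assumes "nonneg_at j p" "p \<in> laurent_ring j"
  shows "nonneg_at j (ld p)"
  unfolding nonneg_at_def
proof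
  fix e' assume "e' \<in> ks (ld p)"
  then show "0 \<le> lk e' (X j) \<and> 0 \<le> lk e' (Y j)"
  proof (rule keys_ld)
    fix e v assume e: "e \<in> ks p" "v \<in> ks e" "e' = e - sg v 1 + dmon (index v)"
    then have "0 \<le> lk e (X j)" "0 \<le> lk e (Y j)" "lk e v \<noteq> 0" "index v \<le> j"
      using assms laurent_ringD[OF assms(2) e(1,2)] by (auto simp: nonneg_at_def in_keys_iff)
    then show ?thesis unfolding e(3)
      by (cases v) (auto simp: lookup_add lookup_minus lookup_single when_def lookup_dmon)
  qed
qed

text \<open>The lowest coefficient \<open>q\<^sub>0\<close> of \<open>p = q\<^sub>0 y\<^sub>j\<^bsup>m\<^esup> + R\<close> evolves on its own, because
  \<open>\<partial>\<close> never lowers the exponent of \<open>x\<^sub>j\<close> and raises it in \<open>\<partial>(y\<^sub>j\<^bsup>m\<^esup>)\<close>.\<close>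

lemma lookup_ld_xcoeff_0:
  assumes "homogeneous p" "p \<in> laurent_ring (Suc j)" "nonneg_at (Suc j) p"
  shows "lk (ld (xcoeff (Suc j) p 0)) e = (if lk e (X (Suc j)) = 0
    then lk (ld p) (e + sg (Y (Suc j)) (pdeg p (Suc j))) else 0)"
proof -
  define J where "J = Suc j"
  define q where "q = xcoeff J p 0"
  define s where "s = sg (Y J) (pdeg p J)"
  \<comment> \<open>\<open>R\<close> collects the monomials with positive exponent in
    \<open>X J\<close>.\<close>
  define R where "R = p - q * lmonom s"
  have qL: "q \<in> laurent_ring j" using assms unfolding q_def J_def by (intro xcoeff_laurent_ring)
  have L0: "lk e (X J) = 0" if "r \<in> laurent_ring j" "e \<in> ks r" for r e
  proof -
    have "X J \<notin> ks e" using laurent_ringD[OF that, of "X J"] by (auto simp: J_def)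
    then show ?thesis by (simp add: in_keys_iff)
  qed
  have Rk: "1 \<le> lk e (X J)" if "e \<in> ks R" for e
  proof -
    have "lk R e = lk p e" if "lk e (X J) \<noteq> 0"
      using that by (simp add: R_def lookup_minus lookup_mult_lmonom q_def lookup_xcoeff s_def lookup_single)
    moreover have "lk R e = 0" if "lk e (X J) = 0"
      using that by (simp add: R_def lookup_minus lookup_mult_lmonom q_def lookup_xcoeff s_def lookup_single)
    ultimately have "lk e (X J) \<noteq> 0" "e \<in> ks p" using that by (metis in_keys_iff)+
    then show ?thesis using assms(3) by (force simp: nonneg_at_def J_def)
  qed
  have ldR: "lk (ld R) e = 0" if "lk e (X J) = 0" for e
  proof (rule ccontr)
    assume "lk (ld R) e \<noteq> 0"
    then have "e \<in> ks (ld R)" by (simp add: in_keys_iff)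
    then show False
    proof (rule keys_ld)
      fix e1 v assume "e1 \<in> ks R" "v \<in> ks e1" "e = e1 - sg v 1 + dmon (index v)"
      then show ?thesis using Rk[of e1] that
        by (cases v) (auto simp: lookup_add lookup_minus lookup_single when_def lookup_dmon split: if_splits)
    qed
  qed
  have qs: "lk (q * ld (lmonom s)) e = 0" if "lk e (X J) = 0" for e
  proof (rule ccontr)
    assume "lk (q * ld (lmonom s)) e \<noteq> 0"
    then have "e \<in> ks (q * ld (lmonom s))" by (simp add: in_keys_iff)
    then obtain e1 e2 where e: "e1 \<in> ks q" "e2 \<in> ks (ld (lmonom s))" "e = e1 + e2"
      using keys_mult by blast
    from e(2) have "lk e2 (X J) = 1"
    proof (rule keys_ld)
      fix e v assume "e \<in> ks (lmonom s)" "v \<in> ks e" "e2 = e - sg v 1 + dmon (index v)"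
      then show ?thesis
        by (auto simp: lmonom_def s_def lookup_add lookup_minus lookup_single lookup_dmon split: if_splits)
    qed
    then show False using that L0[OF qL e(1)] e(3) by (simp add: lookup_add)
  qed
  have "p = q * lmonom s + R" by (simp add: R_def)
  then have p: "ld p = ld q * lmonom s + q * ld (lmonom s) + ld R"
    by (metis ld_add ld_mult)
  show ?thesis
  proof (cases "lk e (X J) = 0")
    case True
    then have "lk (e + s) (X J) = 0" by (simp add: s_def lookup_add lookup_single)
    then have "lk (ld p) (e + s) = lk (ld q) e"
      by (simp add: p lookup_add ldR qs lookup_mult_lmonom)
    then show ?thesis using True by (simp add: q_def s_def J_def)
  next
    case False
    then have "e \<notin> ks (ld q)" using L0[OF laurent_ring_ld[OF qL]] by blast
    then show ?thesis using False by (simp add: in_keys_iff q_def J_def)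
  qed
qed

lemma xcoeff_0_ld:
  assumes "homogeneous p" "p \<in> laurent_ring (Suc j)" "nonneg_at (Suc j) p" "ld p \<noteq> 0"
  shows "xcoeff (Suc j) (ld p) 0 = ld (xcoeff (Suc j) p 0)"
  by (rule poly_mapping_eqI)
     (simp add: lookup_ld_xcoeff_0[OF assms(1-3)] lookup_xcoeff homogeneous_ld[OF assms(1,4)])

text \<open>Used contrapositively: while the derivation does not kill the lowest coefficient, it
  does not kill \<open>p\<close> either.\<close>

lemma ld_xcoeff_0_eq_0:
  assumes "homogeneous p" "p \<in> laurent_ring (Suc j)" "nonneg_at (Suc j) p" "ld p = 0"
  shows "ld (xcoeff (Suc j) p 0) = 0"
  by (rule poly_mapping_eqI) (simp add: lookup_ld_xcoeff_0[OF assms(1-3)] assms(4))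

text \<open>The normal form reached by one division: a polynomial in the last pair that is not
  divisible by \<open>X j\<close>.\<close>

definition regular :: "nat \<Rightarrow> laurent \<Rightarrow> bool" where
  "regular j p \<longleftrightarrow> homogeneous p \<and> p \<in> laurent_ring j \<and> nonneg_at j p \<and> xcoeff j p 0 \<noteq> 0"

lemma regular_pdeg_nonneg:
  assumes "regular j p"
  shows "0 \<le> pdeg p j"
proof -
  obtain e where "e \<in> ks p"
    using assms by (metis regular_def homogeneous_def keys_eq_empty ex_in_conv)
  then show ?thesis
    using assms pdeg_eq[of p e] by (auto simp: regular_def nonneg_at_def mdeg_def)
qed

text \<open>Division shifts the exponents of \<open>X (Suc j)\<close> from the range between
  \<open>xmin\<close> and \<open>xmax\<close> to one starting at 0, whose length is the new degree.
  The recursive part of \<open>reg\<close> involves only lower variables and divides the lowest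
  coefficient by its own regularization monomial.\<close>

lemma regularize:
  assumes "homogeneous q" "q \<in> laurent_ring (Suc j)"
  defines "p \<equiv> q * lmonom (- reg (Suc j) q)" and "c \<equiv> xcoeff (Suc j) q (xmin (Suc j) q)"
  shows "regular (Suc j) p" "xcoeff (Suc j) p 0 = c * lmonom (- reg j c)"
    "pdeg p (Suc j) = xmax (Suc j) q - xmin (Suc j) q"
proof -
  define J where "J = Suc j"
  define d where "d = - reg J q"
  note [simp] = lookup_add lookup_minus lookup_single when_def
  have reg0: "lk (reg j c) (X J) = 0" "lk (reg j c) (Y J) = 0"
    using keys_reg[of j c] by (auto simp: keys_subset_iff vars_def J_def)
  have dX: "lk d (X J) = - xmin J q" and dY: "lk d (Y J) = - (pdeg q J - xmax J q)"
    using reg0 unfolding d_def J_def reg.simps c_def by simp_all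
  have "d - sg (X J) (lk d (X J)) - sg (Y J) (lk d (Y J)) = - reg j c"
    unfolding dX dY unfolding d_def J_def reg.simps c_def
    by (simp add: single_uminus single_diff algebra_simps)
  then have x0: "xcoeff J p 0 = c * lmonom (- reg j c)"
    using xcoeff_mult_lmonom[OF assms(1), of J d 0] by (simp add: p_def d_def[symmetric] J_def[symmetric] dX c_def)
  then show "xcoeff (Suc j) p 0 = c * lmonom (- reg j c)" by (simp add: J_def)
  show "pdeg p (Suc j) = xmax (Suc j) q - xmin (Suc j) q"
    using homogeneous_mult_lmonom(2)[OF assms(1), of d J] dX dY
    by (simp add: p_def d_def J_def mdeg_def)
  note p_J = p_def[folded J_def, folded d_def]
  have "nonneg_at J p"
    unfolding nonneg_at_def
  proof
    fix e assume "e \<in> ks p"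
    then have e: "e - d \<in> ks q" by (simp add: p_J in_keys_mult_lmonom)
    have "lk (e - d) (X J) + lk (e - d) (Y J) = pdeg q J"
      using pdeg_eq[OF assms(1) e] by (simp add: mdeg_def)
    then show "0 \<le> lk e (X J) \<and> 0 \<le> lk e (Y J)"
      using xmin_xmax[OF assms(1) e, of J] dX dY by simp
  qed
  moreover have "c \<noteq> 0" using xmin_xmax_in[OF assms(1)] by (simp add: c_def)
  ultimately show "regular (Suc j) p"
    using homogeneous_mult_lmonom(1)[OF assms(1), of d] x0
      laurent_on_mult[OF assms(2)[folded J_def] laurent_on_lmonom, of d] keys_reg[of J q]
    unfolding p_J[symmetric] by (simp add: regular_def J_def[symmetric] d_def)
qed

section \<open>Iterated steps and termination\<close>

definition dd_step :: "nat \<Rightarrow> laurent \<Rightarrow> laurent" where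
  "dd_step j p = (if ld p = 0 then 0 else ld p * lmonom (- reg j (ld p)))"

lemma dd_seq_funpow: "dd_seq j p k = (dd_step j ^^ k) p"
  by (induction k) (simp_all add: dd_step_def Let_def)

lemma dd_step_eq_0_iff: "dd_step j p = 0 \<longleftrightarrow> ld p = 0"
  by (simp add: dd_step_def)

lemma regular_dd_step:
  assumes "homogeneous p" "p \<in> laurent_ring (Suc j)" "ld p \<noteq> 0"
  shows "regular (Suc j) (dd_step (Suc j) p)"
  using regularize(1)[of "ld p" j] homogeneous_ld[of p] laurent_ring_ld[of p] assms
  by (simp add: dd_step_def)

text \<open>If the lowest coefficient survives the derivation, then \<open>xmin\<close> of
  \<open>ld p\<close> is 0 and this coefficient makes a step of its own. If it is killed,
  \<open>xmin\<close> is positive and the division by a power of \<open>X (Suc j)\<close> lowers the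
  degree.\<close>

lemma dd_step_regular:
  assumes p: "regular (Suc j) p" and "ld p \<noteq> 0"
  defines "c \<equiv> xcoeff (Suc j) p 0"
  shows "pdeg (dd_step (Suc j) p) (Suc j) \<le> pdeg p (Suc j)"
    and "ld c = 0 \<Longrightarrow> pdeg (dd_step (Suc j) p) (Suc j) < pdeg p (Suc j)"
    and "ld c \<noteq> 0 \<Longrightarrow> xcoeff (Suc j) (dd_step (Suc j) p) 0 = dd_step j c"
proof -
  define J where "J = Suc j"
  define q where "q = ld p"
  have p': "homogeneous p" "p \<in> laurent_ring J" "nonneg_at J p"
    using p by (auto simp: regular_def J_def)
  have q: "homogeneous q" "q \<in> laurent_ring J" "nonneg_at J q" "pdeg q = pdeg p"
    using homogeneous_ld[OF p'(1)] laurent_ring_ld[OF p'(2)] nonneg_at_ld[OF p'(3,2)] assms(2)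
    by (auto simp: q_def)
  have xq: "xcoeff J q 0 = ld c"
    using xcoeff_0_ld[OF p'[unfolded J_def] assms(2)] by (simp add: c_def q_def J_def)
  have step: "dd_step J p = q * lmonom (- reg J q)"
    using assms(2) by (simp add: dd_step_def q_def)
  \<comment> \<open>The exponents of \<open>X J\<close> and \<open>Y J\<close> in \<open>q\<close>
    are nonnegative with sum \<open>pdeg p J\<close>.\<close>
  have "{i. xcoeff J q i \<noteq> 0} \<subseteq> {0..pdeg p J}"
    unfolding xcoeff_nonzero[OF q(1)] using q(3) pdeg_eq[OF q(1)] q(4)
    by (fastforce simp: nonneg_at_def mdeg_def)
  then have b: "0 \<le> xmin J q" "xmax J q \<le> pdeg p J"
    using xmin_xmax_in[OF q(1), of J] by fastforce+
  have deg: "pdeg (dd_step J p) J = xmax J q - xmin J q"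
    using regularize(3)[of q j] q step by (simp add: J_def)
  show "pdeg (dd_step (Suc j) p) (Suc j) \<le> pdeg p (Suc j)"
    using b deg by (simp add: J_def)
  show "pdeg (dd_step (Suc j) p) (Suc j) < pdeg p (Suc j)" if "ld c = 0"
  proof -
    have "xmin J q \<noteq> 0" using xmin_xmax_in(1)[OF q(1), of J] xq that by metis
    then show ?thesis using b deg by (simp add: J_def)
  qed
  show "xcoeff (Suc j) (dd_step (Suc j) p) 0 = dd_step j c" if "ld c \<noteq> 0"
  proof -
    have "0 \<in> {i. xcoeff J q i \<noteq> 0}" using xq that by simp
    then have "xmin J q \<le> 0"
      unfolding xcoeff_nonzero[OF q(1)] using xmin_xmax(1)[OF q(1), of _ J] by (metis imageE)
    then have "xmin J q = 0" using b by simp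
    then show ?thesis
      using regularize(2)[of q j] q xq step that by (simp add: J_def dd_step_def)
  qed
qed

lemma dd_iterate_regular:
  assumes p: "regular (Suc j) p" and "(dd_step j ^^ k) (xcoeff (Suc j) p 0) \<noteq> 0"
  shows "regular (Suc j) ((dd_step (Suc j) ^^ k) p) \<and>
    pdeg ((dd_step (Suc j) ^^ k) p) (Suc j) \<le> pdeg p (Suc j) \<and>
    xcoeff (Suc j) ((dd_step (Suc j) ^^ k) p) 0 = (dd_step j ^^ k) (xcoeff (Suc j) p 0)"
  using assms(2)
proof (induction k)
  case (Suc k)
  let ?P = "(dd_step (Suc j) ^^ k) p" and ?c = "(dd_step j ^^ k) (xcoeff (Suc j) p 0)"
  have ldc: "ld ?c \<noteq> 0" using Suc.prems by (simp add: dd_step_eq_0_iff)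
  then have IH: "regular (Suc j) ?P" "pdeg ?P (Suc j) \<le> pdeg p (Suc j)" "xcoeff (Suc j) ?P 0 = ?c"
    using Suc.IH by fastforce+
  have ldP: "ld ?P \<noteq> 0"
    using ld_xcoeff_0_eq_0[of ?P j] IH ldc by (auto simp: regular_def)
  show ?case
    using dd_step_regular(1,3)[OF IH(1) ldP] regular_dd_step[of ?P j] IH ldP ldc
    by (auto simp: regular_def)
qed (use p in simp)

lemma const_0: "const 0 = 0"
  by (simp add: const_def)

text \<open>Outer induction on the number of pairs of variables, inner induction on the degree in
  the last pair.\<close>

lemma dd_terminates:
  assumes "homogeneous p" "p \<in> laurent_ring j"
  shows "\<exists>k. (dd_step j ^^ k) p \<in> range const"
  using assms
proof (induction j arbitrary: p)
  case 0
  have "lk p e = lk (const (lk p 0)) e" for e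
  proof (cases "e = 0")
    case False
    then have "ks e \<noteq> {}" by simp
    then have "e \<notin> ks p" using laurent_ringD[OF 0(2), of e] by fastforce
    then show ?thesis using False by (simp add: const_def lookup_single in_keys_iff)
  qed (simp add: const_def)
  then have "p \<in> range const" by (metis poly_mapping_eqI rangeI)
  then show ?case by (metis funpow_0)
next
  case (Suc j)
  define J where "J = Suc j"
  have shift: "\<exists>k. (dd_step J ^^ k) p \<in> range const"
    if "\<exists>k. (dd_step J ^^ k) ((dd_step J ^^ l) p) \<in> range const" for l p
    using that by (metis comp_apply funpow_add)
  have zero: "\<exists>k. (dd_step J ^^ k) p \<in> range const" if "ld p = 0" for p
  proof -
    \<comment> \<open>A killed element is followed by 0, which is a constant.\<close>
    have "(dd_step J ^^ 1) p = const 0" using that by (simp add: dd_step_eq_0_iff const_0)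
    then show ?thesis by blast
  qed
  have reg: "\<exists>k. (dd_step J ^^ k) p \<in> range const" if "regular J p" for p
    using that
  proof (induction "nat (pdeg p J)" arbitrary: p rule: less_induct)
    case less
    define c where "c = xcoeff J p 0"
    have c: "c \<noteq> 0" "homogeneous c" "c \<in> laurent_ring j"
      using less.prems homogeneous_xcoeff[of p J 0] xcoeff_laurent_ring[of p j 0]
      by (auto simp: c_def regular_def J_def)
    obtain k where "(dd_step j ^^ k) c \<in> range const" using Suc.IH[OF c(2,3)] by blast
    then have "(dd_step j ^^ Suc k) c = 0" by (auto simp: dd_step_eq_0_iff ld_const)
    \<comment> \<open>\<open>l\<close> is the last index at which the lowest coefficient is nonzero.
      Up to there the degree does not grow; the next step lowers it or produces 0.\<close>
    then obtain l where l: "(dd_step j ^^ l) c \<noteq> 0" "(dd_step j ^^ Suc l) c = 0"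
      using c(1) ex_least_nat_less[of "\<lambda>k. (dd_step j ^^ k) c = 0" "Suc k"] by auto
    let ?P = "(dd_step J ^^ l) p"
    have P: "regular J ?P" "pdeg ?P J \<le> pdeg p J" "xcoeff J ?P 0 = (dd_step j ^^ l) c"
      using dd_iterate_regular[of j p l] less.prems l(1) by (auto simp: J_def c_def)
    have "\<exists>k. (dd_step J ^^ k) ?P \<in> range const"
    proof (cases "ld ?P = 0")
      case False
      have reg: "regular J (dd_step J ?P)"
        using regular_dd_step[of ?P j] P(1) False by (auto simp: regular_def J_def)
      moreover have "pdeg (dd_step J ?P) J < pdeg ?P J"
        using dd_step_regular(2)[of j ?P] P False l(2) by (simp add: J_def dd_step_eq_0_iff)
      ultimately have "nat (pdeg (dd_step J ?P) J) < nat (pdeg p J)"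
        using regular_pdeg_nonneg[OF reg] P(2) by linarith
      then have "\<exists>k. (dd_step J ^^ k) (dd_step J ?P) \<in> range const"
        using less.hyps reg by blast
      then show ?thesis using shift[of 1 ?P] by simp
    qed (rule zero)
    then show ?case by (rule shift)
  qed
  show ?case
  \<comment> \<open>A homogeneous \<open>p\<close> need not be regular, but one step with nonzero
    derivative makes it so.\<close>
  proof (cases "ld p = 0")
    case False
    then have "\<exists>k. (dd_step J ^^ k) (dd_step J p) \<in> range const"
      using reg regular_dd_step[OF Suc.prems] by (simp add: J_def)
    then show ?thesis using shift[of 1 p] by (simp add: J_def)
  qed (use zero in \<open>simp add: J_def\<close>)
qed


section \<open>Evaluation of Laurent polynomials\<close>

lemma single_sum_keys:
  "(\<Sum>v\<in>ks e. sg v (lk e v)) = e"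
  by (rule poly_mapping_eqI) (auto simp: lookup_sum lookup_single when_def sum.delta in_keys_iff)

text \<open>Used twice: first to evaluate coefficients at real values of the
  \<open>R\<^sub>i\<close>, then, with that as \<open>coeff_val\<close>, to evaluate Laurent
  polynomials.\<close>

locale evaluation =
  fixes coeff_val :: "'b::comm_semiring_1 \<Rightarrow> real" and mon_val :: "'a::comm_monoid_add \<Rightarrow> real"
  assumes coeff_0: "coeff_val 0 = 0" and coeff_1: "coeff_val 1 = 1"
    and coeff_add: "coeff_val (c + d) = coeff_val c + coeff_val d"
    and coeff_mult: "coeff_val (c * d) = coeff_val c * coeff_val d"
    and mon_0: "mon_val 0 = 1"
    and mon_add: "mon_val (e + e') = mon_val e * mon_val e'"
begin

definition eval :: "('a \<Rightarrow>\<^sub>0 'b) \<Rightarrow> real" where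
  "eval p = (\<Sum>e\<in>ks p. coeff_val (lk p e) * mon_val e)"

lemma eval_superset: "finite A \<Longrightarrow> ks p \<subseteq> A \<Longrightarrow> eval p = (\<Sum>e\<in>A. coeff_val (lk p e) * mon_val e)"
  unfolding eval_def by (rule sum.mono_neutral_left) (auto simp: in_keys_iff coeff_0)

lemma eval_0 [simp]: "eval 0 = 0"
  by (simp add: eval_def)

lemma eval_add: "eval (p + q) = eval p + eval q"
proof -
  have "ks (p + q) \<subseteq> ks p \<union> ks q" by (rule Poly_Mapping.keys_add)
  then show ?thesis
    using eval_superset[of "ks p \<union> ks q" "p + q"] eval_superset[of "ks p \<union> ks q" p]
      eval_superset[of "ks p \<union> ks q" q]
    by (simp add: lookup_add coeff_add distrib_right sum.distrib)
qed

lemma eval_sum: "eval (sum f A) = (\<Sum>i\<in>A. eval (f i))"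
  by (induction A rule: infinite_finite_induct) (simp_all add: eval_add)

lemma eval_single: "eval (sg e c) = coeff_val c * mon_val e"
  using eval_superset[of "{e}" "sg e c"] by simp

lemma eval_1 [simp]: "eval 1 = 1"
  using eval_single[of 0 1] by (simp add: coeff_1 mon_0)

lemma eval_mult: "eval (p * q) = eval p * eval q"
proof -
  have expand: "p = (\<Sum>e\<in>ks p. sg e (lk p e))" for p :: "'a \<Rightarrow>\<^sub>0 'b"
    by (rule single_sum_keys[symmetric])
  have "eval (p * q) = (\<Sum>e\<in>ks p. \<Sum>e'\<in>ks q. eval (sg e (lk p e) * sg e' (lk q e')))"
    by (subst expand[of p], subst expand[of q]) (simp add: sum_product eval_sum)
  also have "\<dots> = eval p * eval q"
    unfolding mult_single eval_single coeff_mult mon_add by (simp add: eval_def sum_product ac_simps)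
  finally show ?thesis .
qed

lemma eval_prod: "eval (prod f A) = (\<Prod>i\<in>A. eval (f i))"
  by (induction A rule: infinite_finite_induct) (simp_all add: eval_mult)

end

lemma prod_keys_superset:
  fixes f :: "'a \<Rightarrow> 'c::zero \<Rightarrow> real"
  assumes "finite A" "ks e \<subseteq> A" "\<And>v. f v 0 = 1"
  shows "(\<Prod>v\<in>ks e. f v (lk e v)) = (\<Prod>v\<in>A. f v (lk e v))"
  by (rule prod.mono_neutral_left) (use assms in \<open>auto simp: in_keys_iff\<close>)

lemma prod_keys_add:
  fixes f :: "'a \<Rightarrow> 'c::monoid_add \<Rightarrow> real"
  assumes "\<And>v. f v 0 = 1" "\<And>v i j. f v (i + j) = f v i * f v j"
  shows "(\<Prod>v\<in>ks (e + e'). f v (lk (e + e') v)) =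
    (\<Prod>v\<in>ks e. f v (lk e v)) * (\<Prod>v\<in>ks e'. f v (lk e' v))"
proof -
  have "ks (e + e') \<subseteq> ks e \<union> ks e'" by (rule Poly_Mapping.keys_add)
  then have "(\<Prod>v\<in>ks (e + e'). f v (lk (e + e') v)) = (\<Prod>v\<in>ks e \<union> ks e'. f v (lk (e + e') v))"
    by (intro prod_keys_superset) (simp_all add: assms)
  also have "\<dots> = (\<Prod>v\<in>ks e \<union> ks e'. f v (lk e v)) * (\<Prod>v\<in>ks e \<union> ks e'. f v (lk e' v))"
    by (simp add: lookup_add assms prod.distrib)
  finally show ?thesis
    by (simp add: prod_keys_superset[of "ks e \<union> ks e'" _ f] assms)
qed


section \<open>The starting polynomial\<close>

lemma laurent_on_1: "1 \<in> laurent_on V"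
  by (simp add: laurent_on_def)

lemma laurent_on_prod: "(\<And>i. i \<in> A \<Longrightarrow> f i \<in> laurent_on V) \<Longrightarrow> prod f A \<in> laurent_on V"
  by (induction A rule: infinite_finite_induct) (auto simp: laurent_on_1 laurent_on_mult)

definition dd_start_mon :: "nat \<Rightarrow> nat \<Rightarrow> lmon" where
  "dd_start_mon n j = (\<Sum>i\<in>{1..<j}. sg (X i) 1) + (\<Sum>i\<in>{j..<n}. sg (Y i) 1)"

lemma keys_dd_start:
  assumes "e \<in> ks (dd_start n)"
  obtains j where "1 \<le> j" "j \<le> n" "e = dd_start_mon n j"
proof -
  have eq: "dd_start n = (\<Sum>j=1..n. sg (dd_start_mon n j) (Delta n * (Delta j - Delta (j - 1))))"
  proof -
    have "const (Delta j - Delta (j - 1)) * (\<Prod>i\<in>{1..<j}. var (X i)) * (\<Prod>i\<in>{j..<n}. var (Y i))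
        = sg (dd_start_mon n j) (Delta j - Delta (j - 1))" for j
      by (simp add: var_def dd_start_mon_def mult.assoc flip: lmonom_sum lmonom_add)
         (simp add: const_def lmonom_def mult_single)
    then show ?thesis
      by (simp add: dd_start_def sum_distrib_left) (simp add: const_def mult_single)
  qed
  have "e \<in> (\<Union>j\<in>{1..n}. ks (sg (dd_start_mon n j) (Delta n * (Delta j - Delta (j - 1)))))"
    using subsetD[OF keys_sum assms[unfolded eq]] .
  then show ?thesis using that by (auto split: if_splits)
qed

lemma lookup_dd_start_mon:
  "lk (dd_start_mon n j) (X i) = (if 1 \<le> i \<and> i < j then 1 else 0)"
  "lk (dd_start_mon n j) (Y i) = (if j \<le> i \<and> i < n then 1 else 0)"
  by (auto simp: dd_start_mon_def lookup_add lookup_sum lookup_single when_def)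

lemma dd_start_laurent_ring: "dd_start n \<in> laurent_ring (n - 1)"
  unfolding laurent_on_def
proof (intro CollectI ballI)
  fix e assume "e \<in> ks (dd_start n)"
  then obtain j where j: "1 \<le> j" "j \<le> n" "e = dd_start_mon n j" by (rule keys_dd_start)
  show "ks e \<subseteq> vars (n - 1)"
    unfolding keys_subset_iff
  proof (intro allI impI)
    fix v assume "v \<notin> vars (n - 1)"
    then show "lk e v = 0" using j by (cases v) (auto simp: lookup_dd_start_mon vars_def)
  qed
qed

text \<open>Every monomial contains exactly one of \<open>X i\<close> and \<open>Y i\<close> for
  each \<open>i\<close> from 1 to \<open>n - 1\<close>.\<close>

lemma homogeneous_dd_start: "dd_start n \<noteq> 0 \<Longrightarrow> homogeneous (dd_start n)"
proof (rule homogeneousI)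
  fix e assume "e \<in> ks (dd_start n)"
  then obtain j where "1 \<le> j" "j \<le> n" "e = dd_start_mon n j" by (rule keys_dd_start)
  then show "mdeg e = (\<lambda>i. if 1 \<le> i \<and> i < n then 1 else 0)"
    by (auto simp: mdeg_def lookup_dd_start_mon)
qed

text \<open>Additivity of logarithmic derivatives, written without division: \<open>s\<close> and
  \<open>t\<close> stand for \<open>ld p / p\<close> and \<open>ld q / q\<close>.\<close>

lemma log_ld_mult: "ld p = p * s \<Longrightarrow> ld q = q * t \<Longrightarrow> ld (p * q) = p * q * (s + t)"
  by (simp add: ld_mult algebra_simps)

lemma log_ld_inv_var: "ld (var v) = var v * s \<Longrightarrow> ld (inv_var v) = inv_var v * (- s)"
proof -
  assume s: "ld (var v) = var v * s"
  have "ld (var v * inv_var v) = 0" using ld_const[of 1] by (simp add: const_def var_inv_var)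
  then have "inv_var v * (var v * s * inv_var v + var v * ld (inv_var v)) = 0"
    by (simp add: ld_mult s)
  then have "(var v * inv_var v) * (s * inv_var v) + (var v * inv_var v) * ld (inv_var v) = 0"
    by (simp add: algebra_simps)
  then have "s * inv_var v + ld (inv_var v) = 0" by (simp add: var_inv_var)
  then show "ld (inv_var v) = inv_var v * (- s)"
    by (simp add: eq_neg_iff_add_eq_0 add.commute mult.commute)
qed

definition quot_prod :: "nat \<Rightarrow> laurent" where
  "quot_prod j = (\<Prod>i\<in>{1..<j}. var (X i) * inv_var (Y i))"

lemma quot_prod_Suc: "1 \<le> j \<Longrightarrow> quot_prod (Suc j) = quot_prod j * (var (X j) * inv_var (Y j))"
  by (simp add: quot_prod_def prod.atLeastLessThan_Suc)

lemma log_ld_X: "ld (var (X j)) = var (X j) * (const (Delta j) * quot_prod j)"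
  by (simp add: ld_x quot_prod_def ac_simps)

text \<open>The derivative of \<open>Y j\<close> contains \<open>X j\<close>; their quotient is the
  next factor of \<open>quot_prod\<close>, which raises its index by one.\<close>

lemma log_ld_inv_Y:
  assumes "1 \<le> j"
  shows "ld (inv_var (Y j)) = inv_var (Y j) * (- (const (Delta j) * quot_prod (Suc j)))"
proof (rule log_ld_inv_var)
  have "var (Y j) * (const (Delta j) * quot_prod (Suc j)) =
      (var (Y j) * inv_var (Y j)) * (const (Delta j) * var (X j) * quot_prod j)"
    using assms by (simp add: quot_prod_Suc ac_simps)
  then show "ld (var (Y j)) = var (Y j) * (const (Delta j) * quot_prod (Suc j))"
    by (simp add: ld_y ld_x quot_prod_def var_inv_var)
qed

text \<open>The logarithmic derivative of the first derivative of \<open>g\<^sub>n\<close>: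
  \<open>Delta j\<close> comes from \<open>X j\<close>, and \<open>- Delta (j - 1)\<close> from the
  inverse of \<open>Y (j - 1)\<close>, or of \<open>X 0\<close> when \<open>j = 1\<close>.\<close>

definition log_sum :: "nat \<Rightarrow> laurent" where
  "log_sum n = (\<Sum>j=1..n. const (Delta j - Delta (j - 1)) * quot_prod j)"

lemma const_diff: "const (c - d) = const c - const d"
  by (simp add: const_def single_diff)

text \<open>The index 0 serves for the real variable: \<open>Delta 0\<close> and the product in
  \<open>deriv_var (X 0)\<close> are 1, so \<open>ld\<close> maps \<open>X 0\<close> to itself, as
  \<open>x d/dx\<close> does with \<open>x\<close>. Up to the factor \<open>Delta n\<close>, the
  argument of \<open>ld\<close> is the first derivative of \<open>g\<^sub>n\<close>.\<close>

lemma log_ld_Y_deriv: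
  assumes "1 \<le> n"
  shows "ld (quot_prod n * var (X n) * inv_var (X 0)) =
    quot_prod n * var (X n) * inv_var (X 0) * log_sum n"
proof -
  \<comment> \<open>The \<open>+ 1\<close> offsets the \<open>- Delta 0\<close> in
    \<open>log_sum\<close>; the factor \<open>inv_var (X 0)\<close> removes it again.\<close>
  have "ld (quot_prod n * var (X n)) = quot_prod n * var (X n) * (log_sum n + 1)"
    using assms
  proof (induction n rule: nat_induct_at_least)
    case base
    have "quot_prod 1 = 1" "Delta 0 = 1" by (simp_all add: quot_prod_def Delta_def)
    moreover have "const 1 = 1" by (simp add: const_def)
    ultimately show ?case by (simp add: log_ld_X log_sum_def const_diff)
  next
    case (Suc n)
    have "ld (quot_prod n * var (X n) * inv_var (Y n) * var (X (Suc n))) =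
        quot_prod n * var (X n) * inv_var (Y n) * var (X (Suc n)) *
        (log_sum n + 1 + - (const (Delta n) * quot_prod (Suc n)) + const (Delta (Suc n)) * quot_prod (Suc n))"
      by (intro log_ld_mult Suc.IH log_ld_inv_Y Suc.hyps log_ld_X)
    moreover have "quot_prod n * var (X n) * inv_var (Y n) * var (X (Suc n)) = quot_prod (Suc n) * var (X (Suc n))"
      using Suc.hyps by (simp add: quot_prod_Suc ac_simps)
    moreover have "log_sum n + 1 + - (const (Delta n) * quot_prod (Suc n)) + const (Delta (Suc n)) * quot_prod (Suc n)
        = log_sum (Suc n) + 1"
      by (simp add: log_sum_def const_diff algebra_simps)
    ultimately show ?case by (simp only:)
  qed
  moreover have "ld (inv_var (X 0)) = inv_var (X 0) * (- 1)"
  proof (rule log_ld_inv_var)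
    have "const (Delta 0) * quot_prod 0 = 1" by (simp add: Delta_def const_def quot_prod_def)
    then show "ld (var (X 0)) = var (X 0) * 1" using log_ld_X[of 0] by simp
  qed
  ultimately have "ld (quot_prod n * var (X n) * inv_var (X 0)) =
    quot_prod n * var (X n) * inv_var (X 0) * (log_sum n + 1 + - 1)"
    by (rule log_ld_mult)
  then show ?thesis by simp
qed

lemma dd_start_log_sum: "dd_start n = const (Delta n) * log_sum n * (\<Prod>i\<in>{1..<n}. var (Y i))"
proof -
  have "(\<Prod>i\<in>{1..<j}. var (X i)) * (\<Prod>i\<in>{j..<n}. var (Y i)) = quot_prod j * (\<Prod>i\<in>{1..<n}. var (Y i))"
    if "j \<in> {1..n}" for j
  proof -
    have "{1..<n} = {1..<j} \<union> {j..<n}" using that by auto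
    then have "(\<Prod>i\<in>{1..<n}. var (Y i)) = (\<Prod>i\<in>{1..<j}. var (Y i)) * (\<Prod>i\<in>{j..<n}. var (Y i))"
      by (simp add: prod.union_disjoint)
    moreover have "quot_prod j * (\<Prod>i\<in>{1..<j}. var (Y i)) = (\<Prod>i\<in>{1..<j}. var (X i))"
    proof -
      have "var (X i) * inv_var (Y i) * var (Y i) = var (X i)" for i
        by (simp add: mult.assoc mult.commute[of "inv_var _"] var_inv_var)
      then show ?thesis by (simp add: quot_prod_def flip: prod.distrib)
    qed
    ultimately show ?thesis by (simp only: mult.assoc[symmetric])
  qed
  then show ?thesis
    by (simp add: dd_start_def log_sum_def sum_distrib_right mult.assoc)
qed

text \<open>Since \<open>d/dx\<close> is \<open>ld\<close> followed by division by
  \<open>X 0\<close>, the left side is the second derivative of \<open>g\<^sub>n\<close>. Clearing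
  the denominators \<open>Y i\<close> of its logarithmic factor yields
  \<open>dd_start\<close>.\<close>

lemma ld_ld_Y:
  assumes "1 \<le> n"
  shows "ld (ld (var (Y n)) * inv_var (X 0)) * inv_var (X 0) =
    var (X n) * quot_prod n * inv_var (X 0) * inv_var (X 0) * (\<Prod>i\<in>{1..<n}. inv_var (Y i)) * dd_start n"
proof -
  have "ld (var (Y n)) * inv_var (X 0) = const (Delta n) * (quot_prod n * var (X n) * inv_var (X 0))"
    by (simp add: ld_y ld_x quot_prod_def ac_simps)
  then have "ld (ld (var (Y n)) * inv_var (X 0)) =
      const (Delta n) * (quot_prod n * var (X n) * inv_var (X 0) * log_sum n)"
    by (simp add: ld_mult[of "const (Delta n)"] ld_const log_ld_Y_deriv[OF assms])
  moreover have "(\<Prod>i\<in>{1..<n}. inv_var (Y i)) * dd_start n = const (Delta n) * log_sum n"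
  proof -
    have "(\<Prod>i\<in>{1..<n}. inv_var (Y i)) * dd_start n =
        const (Delta n) * log_sum n * (\<Prod>i\<in>{1..<n}. var (Y i) * inv_var (Y i))"
      unfolding dd_start_log_sum prod.distrib by (simp only: ac_simps)
    then show ?thesis by (simp add: var_inv_var)
  qed
  ultimately show ?thesis by (simp add: mult.assoc)
qed


section \<open>The bound on the number of roots\<close>

locale composite_power =
  fixes a r :: "nat \<Rightarrow> real" and n :: nat
begin

section \<open>Evaluation at the functions \<open>g\<close> and their powers\<close>

definition S :: "real set" where
  "S = dom_I a r n"

sublocale R: evaluation "of_int :: int \<Rightarrow> real" "\<lambda>e. \<Prod>i\<in>ks e. r i ^ lk e i"
  by unfold_locales (simp_all add: prod_keys_add[of "\<lambda>i k. r i ^ k"] power_add)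

text \<open>The value 1 outside the domain makes evaluation multiplicative on all Laurent monomials.\<close>

definition val :: "real \<Rightarrow> lvar \<Rightarrow> real" where
  "val x v = (if index v \<le> n \<and> x \<in> S then
     (case v of X 0 \<Rightarrow> x | X (Suc j) \<Rightarrow> g a r j x powr r (Suc j) | Y j \<Rightarrow> g a r j x) else 1)"

lemma g_pos: "x \<in> S \<Longrightarrow> j \<le> n \<Longrightarrow> 0 < g a r j x"
  by (auto simp: S_def dom_I_def)

lemma val_Y: "x \<in> S \<Longrightarrow> j \<le> n \<Longrightarrow> val x (Y j) = g a r j x"
  by (simp add: val_def)

lemma val_pos: "0 < val x v"
proof -
  have "0 < x" if "x \<in> S" using g_pos[OF that, of 0] by simp
  moreover have "g a r j x \<noteq> 0" "0 < g a r j x" if "x \<in> S" "j \<le> n" for j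
    using g_pos[OF that] by auto
  ultimately show ?thesis
    by (auto simp: val_def split: lvar.split nat.split)
qed

sublocale E: evaluation R.eval "\<lambda>e. \<Prod>v\<in>ks e. val x v powi lk e v" for x
proof
  have "val x v \<noteq> 0" for v using val_pos[of x v] by simp
  then show "(\<Prod>v\<in>ks (e + e'). val x v powi lk (e + e') v) =
      (\<Prod>v\<in>ks e. val x v powi lk e v) * (\<Prod>v\<in>ks e'. val x v powi lk e' v)" for e e'
    by (intro prod_keys_add) (simp_all add: power_int_add)
qed (simp_all add: R.eval_add R.eval_mult)

abbreviation E :: "real \<Rightarrow> laurent \<Rightarrow> real" where
  "E x \<equiv> E.eval x"

lemma R_Delta: "R.eval (Delta j) = (\<Prod>k=1..j. r k)"
  by (simp add: Delta_def R.eval_prod Rvar_def R.eval_single)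

lemma E_const: "E x (const c) = R.eval c"
  by (simp add: const_def E.eval_single)

lemma E_lmonom: "E x (lmonom e) = (\<Prod>v\<in>ks e. val x v powi lk e v)"
  by (simp add: lmonom_def E.eval_single)

lemma E_lmonom_pos: "0 < E x (lmonom e)"
  unfolding E_lmonom by (intro prod_pos) (simp add: val_pos)

lemma E_var: "E x (var v) = val x v"
  by (simp add: var_def E_lmonom)

lemma E_inv_var: "E x (inv_var v) = inverse (val x v)"
  by (simp add: inv_var_def E_lmonom power_int_minus)

text \<open>Unlike \<open>vars n\<close>, this includes index 0, so that division by
  \<open>x\<close> stays in the ring.\<close>

definition low_vars :: "lvar set" where
  "low_vars = {v. index v \<le> n}"

lemma laurent_on_low_ld: "p \<in> laurent_on low_vars \<Longrightarrow> ld p \<in> laurent_on low_vars"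
proof (erule laurent_on_ld)
  fix v assume v: "v \<in> low_vars"
  show "ks (dmon (index v)) \<subseteq> low_vars"
    unfolding keys_subset_iff
  proof (intro allI impI)
    fix w assume "w \<notin> low_vars"
    then show "lk (dmon (index v)) w = 0"
      using v by (cases w) (auto simp: lookup_dmon low_vars_def)
  qed
qed

lemma laurent_on_low_var: "index v \<le> n \<Longrightarrow> var v \<in> laurent_on low_vars"
  and laurent_on_low_inv_var: "index v \<le> n \<Longrightarrow> inv_var v \<in> laurent_on low_vars"
  unfolding var_def inv_var_def by (rule laurent_on_lmonom; simp add: low_vars_def)+

section \<open>The derivation as \<open>x d/dx\<close>\<close>

lemma E_deriv_var:
  "E x (deriv_var v) = (\<Prod>k=1..index v. r k) * val x (X (index v)) *
     (\<Prod>i\<in>{1..<index v}. val x (X i) / val x (Y i))"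
  by (simp add: deriv_var_def E.eval_mult E.eval_prod E_const R_Delta E_var E_inv_var divide_inverse)

text \<open>The chain rule for \<open>g\<^sub>j\<close> raised to \<open>r (Suc j)\<close>: on
  \<open>S\<close> the quotient of \<open>X (Suc j)\<close> by \<open>Y j\<close> is
  \<open>g\<^sub>j\<close> to the power \<open>r (Suc j) - 1\<close>.\<close>

lemma E_deriv_Y_Suc:
  assumes "x \<in> S" "Suc j \<le> n"
  shows "E x (deriv_var (Y (Suc j))) =
    r (Suc j) * val x (X (Suc j)) / val x (Y j) * E x (deriv_var (Y j))"
proof (cases j)
  case 0
  have "val x (X 0) = val x (Y 0)" by (simp add: val_def)
  then show ?thesis using val_pos[of x "Y 0"] by (simp add: E_deriv_var 0)
next
  case (Suc i)
  have "{1..<Suc j} = insert j {1..<j}" using Suc by auto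
  then show ?thesis by (simp add: E_deriv_var field_simps)
qed

lemma DERIV_g:
  assumes "x \<in> S"
  shows "j \<le> n \<Longrightarrow> (g a r j has_real_derivative E x (deriv_var (Y j)) / x) (at x)"
    and "Suc j \<le> n \<Longrightarrow> ((\<lambda>t. g a r j t powr r (Suc j)) has_real_derivative
      E x (deriv_var (Y (Suc j))) / x) (at x)"
proof -
  have x: "0 < x" using g_pos[OF assms, of 0] by simp
  have step: "((\<lambda>t. g a r j t powr r (Suc j)) has_real_derivative
      E x (deriv_var (Y (Suc j))) / x) (at x)"
    if "Suc j \<le> n" "(g a r j has_real_derivative E x (deriv_var (Y j)) / x) (at x)" for j
  proof -
    have g: "0 < g a r j x" using g_pos[OF assms] that by simp
    have "((\<lambda>t. g a r j t powr r (Suc j)) has_real_derivative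
        r (Suc j) * g a r j x powr (r (Suc j) - 1) * (E x (deriv_var (Y j)) / x)) (at x)"
      using that(2) g by (auto intro!: derivative_eq_intros simp: powr_diff)
    also have "r (Suc j) * g a r j x powr (r (Suc j) - 1) * (E x (deriv_var (Y j)) / x) =
        E x (deriv_var (Y (Suc j))) / x"
      using g that assms unfolding E_deriv_Y_Suc[OF assms that(1)]
      by (simp add: val_def powr_diff)
    finally show ?thesis .
  qed
  have Y: "(g a r j has_real_derivative E x (deriv_var (Y j)) / x) (at x)" if "j \<le> n" for j
    using that
  proof (induction j)
    case 0
    have "val x (X 0) = x" using assms by (simp add: val_def)
    then have "E x (deriv_var (Y 0)) / x = 1" using x by (simp add: E_deriv_var)
    moreover have "g a r 0 = (\<lambda>t. t)" by auto
    ultimately show ?case by simp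
  next
    case (Suc j)
    have "g a r (Suc j) = (\<lambda>t. a (Suc j) + g a r j t powr r (Suc j))" by auto
    moreover have "((\<lambda>t. a (Suc j) + g a r j t powr r (Suc j)) has_real_derivative
        0 + E x (deriv_var (Y (Suc j))) / x) (at x)"
      using step[of j] Suc by (intro DERIV_add DERIV_const) simp
    ultimately show ?case by simp
  qed
  show "j \<le> n \<Longrightarrow> (g a r j has_real_derivative E x (deriv_var (Y j)) / x) (at x)"
    by (rule Y)
  show "Suc j \<le> n \<Longrightarrow> ((\<lambda>t. g a r j t powr r (Suc j)) has_real_derivative
      E x (deriv_var (Y (Suc j))) / x) (at x)"
    using step Y by simp
qed

lemma open_S: "open S" and interval_S: "is_interval S"
  unfolding S_def by (rule open_dom_I is_interval_dom_I)+

lemma DERIV_val: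
  assumes "x \<in> S" "index v \<le> n"
  shows "((\<lambda>t. val t v) has_real_derivative E x (deriv_var v) / x) (at x)"
proof -
  define f where "f t = (case v of X 0 \<Rightarrow> t | X (Suc j) \<Rightarrow> g a r j t powr r (Suc j) | Y j \<Rightarrow> g a r j t)" for t
  have idx: "E x (deriv_var (X j)) = E x (deriv_var (Y j))" for j by (simp add: E_deriv_var)
  have g0: "g a r 0 = (\<lambda>t. t)" by auto
  have "(f has_real_derivative E x (deriv_var v) / x) (at x)"
  proof (cases v)
    case (X j)
    show ?thesis
    proof (cases j)
      case 0
      then have "f = g a r 0" using X g0 by (simp add: f_def fun_eq_iff)
      then show ?thesis using DERIV_g(1)[OF assms(1), of 0] X 0 by (simp add: idx)
    next
      case (Suc i)
      then have "f = (\<lambda>t. g a r i t powr r (Suc i))" using X by (simp add: f_def fun_eq_iff)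
      then show ?thesis using DERIV_g(2)[OF assms(1), of i] X Suc assms(2) by (simp add: idx)
    qed
  next
    case (Y j)
    then have "f = g a r j" by (simp add: f_def fun_eq_iff)
    then show ?thesis using DERIV_g(1)[OF assms(1), of j] assms(2) Y by simp
  qed
  then show ?thesis
    by (rule has_field_derivative_transform_within_open[OF _ open_S assms(1)])
       (use assms in \<open>auto simp: val_def f_def\<close>)
qed

text \<open>Evaluation turns \<open>ld\<close> into \<open>x d/dx\<close>. Closure under sums and
  products reduces this to the variables and their inverses.\<close>

definition compatible :: "laurent \<Rightarrow> bool" where
  "compatible p \<longleftrightarrow> (\<forall>x\<in>S. ((\<lambda>t. E t p) has_real_derivative E x (ld p) / x) (at x))"

lemma compatible_const: "compatible (const c)"
  by (simp add: compatible_def E_const ld_const)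

lemma compatible_1: "compatible 1"
  using compatible_const[of 1] by (simp add: const_def)

lemma compatible_add: "compatible p \<Longrightarrow> compatible q \<Longrightarrow> compatible (p + q)"
  by (auto simp: compatible_def E.eval_add ld_add add_divide_distrib intro!: DERIV_add)

lemma compatible_mult: "compatible p \<Longrightarrow> compatible q \<Longrightarrow> compatible (p * q)"
  by (auto simp: compatible_def E.eval_mult E.eval_add ld_mult add_divide_distrib
      intro!: derivative_eq_intros)

lemma compatible_0: "compatible 0"
  by (simp add: compatible_def)

lemma compatible_sum: "(\<And>i. i \<in> A \<Longrightarrow> compatible (f i)) \<Longrightarrow> compatible (sum f A)"
  by (induction A rule: infinite_finite_induct) (auto simp: compatible_0 compatible_add)

lemma compatible_prod: "(\<And>i. i \<in> A \<Longrightarrow> compatible (f i)) \<Longrightarrow> compatible (prod f A)"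
  by (induction A rule: infinite_finite_induct) (auto simp: compatible_1 compatible_mult)

lemma compatible_var: "index v \<le> n \<Longrightarrow> compatible (var v)"
  using DERIV_val by (simp add: compatible_def E_var ld_var)

lemma compatible_inv_var:
  assumes "index v \<le> n"
  shows "compatible (inv_var v)"
  unfolding compatible_def
proof
  fix x assume x: "x \<in> S"
  have pos: "0 < val x v" by (rule val_pos)
  have "ld 1 = 0" using ld_const[of 1] by (simp add: const_def)
  \<comment> \<open>The derivative of the inverse is found by differentiating the product 1.\<close>
  then have "E x (ld (var v * inv_var v)) = 0" by (simp add: var_inv_var)
  then have "E x (deriv_var v) * inverse (val x v) + val x v * E x (ld (inv_var v)) = 0"
    by (simp add: ld_mult E.eval_mult E.eval_add E_var E_inv_var ld_var)
  then have "E x (ld (inv_var v)) = - (inverse (val x v) * E x (deriv_var v) * inverse (val x v))"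
    using pos by (simp add: field_simps)
  then show "((\<lambda>t. E t (inv_var v)) has_real_derivative E x (ld (inv_var v)) / x) (at x)"
    unfolding E_inv_var using DERIV_val[OF x assms] pos
    by (auto intro!: derivative_eq_intros)
qed

lemma compatible_single_power:
  assumes "index v \<le> n"
  shows "compatible (lmonom (sg v k))"
proof (induction k rule: int_induct[where k = 0])
  case base
  then show ?case by (simp add: lmonom_0 compatible_1)
next
  case (step1 k)
  then show ?case
    using compatible_mult[OF _ compatible_var[OF assms]]
    by (simp add: single_add lmonom_add var_def)
next
  case (step2 k)
  have "sg v (k - 1) = sg v k + sg v (- 1)" by (subst single_add[symmetric]) simp
  with step2 show ?case
    using compatible_mult[OF _ compatible_inv_var[OF assms]]
    by (simp add: lmonom_add inv_var_def)
qed

lemma compatible_laurent: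
  assumes "p \<in> laurent_on low_vars"
  shows "compatible p"
proof -
  have "compatible (lmonom e)" if "e \<in> ks p" for e
  proof -
    have "lmonom e = (\<Prod>v\<in>ks e. lmonom (sg v (lk e v)))"
      using single_sum_keys[of e] by (simp flip: lmonom_sum)
    moreover have "ks e \<subseteq> low_vars" using that assms by (auto simp: laurent_on_def)
    ultimately show ?thesis
      using compatible_prod[of "ks e" "\<lambda>v. lmonom (sg v (lk e v))"] compatible_single_power
      by (auto simp: low_vars_def)
  qed
  then have "compatible (\<Sum>e\<in>ks p. const (lk p e) * lmonom e)"
    by (intro compatible_sum compatible_mult compatible_const)
  moreover have "(\<Sum>e\<in>ks p. const (lk p e) * lmonom e) = p"
    using single_sum_keys[of p] by (simp add: const_def lmonom_def mult_single)
  ultimately show ?thesis by simp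
qed

lemma E_inv_X0: "x \<in> S \<Longrightarrow> E x (inv_var (X 0)) = inverse x"
  unfolding E_inv_var by (simp add: val_def)

text \<open>With \<open>inv_var (X 0)\<close> in place of division by \<open>x\<close>, the
  derivative is again an evaluation. The evaluations thus form a family closed under
  differentiation, as \<open>smooth_on_coinduct\<close> requires.\<close>

lemma DERIV_E:
  assumes "p \<in> laurent_on low_vars" "x \<in> S"
  shows "((\<lambda>t. E t p) has_real_derivative E x (ld p * inv_var (X 0))) (at x)"
  using compatible_laurent[OF assms(1)] assms(2)
  by (auto simp: compatible_def E.eval_mult E_inv_X0 divide_inverse)

lemma smooth_E:
  assumes "p \<in> laurent_on low_vars"
  shows "smooth_on S (\<lambda>t. E t p)"
proof (rule smooth_on_coinduct[OF open_S, where F = "(\<lambda>p t. E t p) ` laurent_on low_vars"])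
  fix f assume "f \<in> (\<lambda>p t. E t p) ` laurent_on low_vars"
  then obtain p where p: "p \<in> laurent_on low_vars" "f = (\<lambda>t. E t p)" by blast
  then have "ld p * inv_var (X 0) \<in> laurent_on low_vars"
    by (intro laurent_on_mult laurent_on_low_ld laurent_on_low_inv_var) auto
  then show "\<exists>h\<in>(\<lambda>p t. E t p) ` laurent_on low_vars. \<forall>x\<in>S. (f has_real_derivative h x) (at x)"
    using DERIV_E[OF p(1)] unfolding p(2) by (intro bexI[of _ "\<lambda>t. E t (ld p * inv_var (X 0))"]) auto
qed (use assms in blast)

text \<open>The derivative of the evaluated \<open>p\<close> is that of \<open>dd_step j p\<close>
  times a monomial \<open>u\<close> with nonzero values; Rolle adds one zero.\<close>

lemma zeros_bound_dd_step:
  assumes "p \<in> laurent_on low_vars" "dd_step j p \<in> laurent_on low_vars" "j \<le> n"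
    and "zeros_bound (\<lambda>t. E t (dd_step j p)) S N"
  shows "zeros_bound (\<lambda>t. E t p) S (Suc N)"
proof (rule zeros_bound_Rolle[OF interval_S open_S smooth_E[OF assms(1)]])
  define u where "u = lmonom (reg j (ld p)) * inv_var (X 0)"
  have "vars j \<subseteq> low_vars" using assms(3) by (auto simp: vars_def low_vars_def)
  then have u: "u \<in> laurent_on low_vars"
    unfolding u_def using keys_reg[of j "ld p"]
    by (intro laurent_on_mult laurent_on_lmonom laurent_on_low_inv_var) auto
  \<comment> \<open>Also true for \<open>ld p = 0\<close>, where the step gives 0.\<close>
  have lp: "ld p = dd_step j p * lmonom (reg j (ld p))"
    by (simp add: dd_step_def mult.assoc lmonom_0 flip: lmonom_add)
  have *: "ld p * inv_var (X 0) = u * dd_step j p"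
    by (subst lp) (simp add: u_def ac_simps)
  show "zeros_bound (deriv (\<lambda>t. E t p)) S N"
  proof (rule zeros_bound_unit[OF open_S smooth_E[OF u] smooth_E[OF assms(2)] _ _ assms(4)])
    fix x assume "x \<in> S"
    then show "deriv (\<lambda>t. E t p) x = E x u * E x (dd_step j p)"
      using DERIV_imp_deriv[OF DERIV_E[OF assms(1)]] by (simp only: * E.eval_mult)
    show "E x u \<noteq> 0"
      using E_lmonom_pos[of x "reg j (ld p)"] val_pos[of x "X 0"]
      by (simp add: u_def E.eval_mult E_inv_var)
  qed
qed

lemma zeros_bound_dd:
  assumes p: "p \<in> laurent_ring j" "j \<le> n" and "(dd_step j ^^ k) p \<in> range const"
  shows "zeros_bound (\<lambda>t. E t p) S k"
proof -
  have low: "q \<in> laurent_on low_vars" if "q \<in> laurent_ring j" for q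
    by (rule laurent_on_mono[OF _ that]) (use assms(2) in \<open>auto simp: vars_def low_vars_def\<close>)
  have step: "dd_step j q \<in> laurent_ring j" if "q \<in> laurent_ring j" for q
  proof -
    have "ld q * lmonom (- reg j (ld q)) \<in> laurent_ring j"
      using laurent_ring_ld[OF that] keys_reg[of j "ld q"]
      by (intro laurent_on_mult laurent_on_lmonom) auto
    then show ?thesis by (simp add: dd_step_def laurent_on_def)
  qed
  show ?thesis
    using p(1) assms(3)
  proof (induction k arbitrary: p)
    case 0
    then show ?case by (auto simp: E_const zeros_bound_const)
  next
    case (Suc k)
    have "(dd_step j ^^ k) (dd_step j p) \<in> range const" using Suc.prems(2) by (simp add: funpow_swap1)
    then show ?case
      using Suc.IH[OF step[OF Suc.prems(1)]] zeros_bound_dd_step[of p j k] low step Suc.prems(1) p(2)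
      by blast
  qed
qed

text \<open>Two differentiations remove \<open>b * x\<close> and leave \<open>dd_start n\<close>
  times the zero-free \<open>u\<close>. Returning to \<open>phi\<close> costs one root each
  time.\<close>

lemma zeros_bound_deriv2:
  assumes "1 \<le> n" and dd: "zeros_bound (\<lambda>t. E t (dd_start n)) S N"
    and low: "dd_start n \<in> laurent_on low_vars"
  shows "zeros_bound (phi a r n b) S (N + 2)"
proof -
  define G where "G = ld (var (Y n)) * inv_var (X 0)"
  define u where "u = var (X n) * quot_prod n * inv_var (X 0) * inv_var (X 0)
      * (\<Prod>i\<in>{1..<n}. inv_var (Y i))"
  have G: "G \<in> laurent_on low_vars" "ld G * inv_var (X 0) \<in> laurent_on low_vars"
    unfolding G_def by (intro laurent_on_mult laurent_on_low_ld laurent_on_low_var laurent_on_low_inv_var; simp)+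
  have u: "u \<in> laurent_on low_vars"
    unfolding u_def quot_prod_def
    by (intro laurent_on_mult laurent_on_prod laurent_on_low_var laurent_on_low_inv_var) auto
  have Eu: "E x u \<noteq> 0" for x
    using val_pos[of x] by (simp add: u_def quot_prod_def E.eval_mult E.eval_prod E_var E_inv_var less_imp_neq[symmetric])
  have eq: "ld G * inv_var (X 0) = u * dd_start n"
    unfolding G_def u_def using assms(1) by (rule ld_ld_Y)
  have "((\<lambda>t. E t (var (Y n)) - b * t) has_real_derivative E x G - b) (at x)" if "x \<in> S" for x
    using DERIV_E[OF laurent_on_low_var[of "Y n"] that] unfolding G_def
    by (auto intro!: derivative_eq_intros)
  \<comment> \<open>The functions are compared only on \<open>S\<close>, because \<open>val\<close>
    has its default value outside.\<close>
  then have D1: "(phi a r n b has_real_derivative E x G - b) (at x)" if "x \<in> S" for x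
    by (rule has_field_derivative_transform_within_open[OF _ open_S that])
       (use that in \<open>auto simp: phi_def E_var val_Y\<close>)
  have D2: "(deriv (phi a r n b) has_real_derivative E x (ld G * inv_var (X 0))) (at x)" if "x \<in> S" for x
  proof (rule has_field_derivative_transform_within_open[OF _ open_S that])
    show "((\<lambda>t. E t G - b) has_real_derivative E x (ld G * inv_var (X 0))) (at x)"
      using DERIV_E[OF G(1) that] by (auto intro!: derivative_eq_intros)
  qed (simp add: DERIV_imp_deriv[OF D1])
  have s: "smooth_on S (deriv (phi a r n b))" "smooth_on S (phi a r n b)"
  proof -
    show "smooth_on S (deriv (phi a r n b))"
      using smooth_on_I[OF open_S D2 smooth_E[OF G(2)]] .
    then show "smooth_on S (phi a r n b)"
      by (rule smooth_on_I[OF open_S, rotated]) (simp add: D1 DERIV_imp_deriv[OF D1])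
  qed
  have "zeros_bound (deriv (deriv (phi a r n b))) S N"
  proof (rule zeros_bound_unit[OF open_S smooth_E[OF u] smooth_E[OF low] Eu _ dd])
    show "deriv (deriv (phi a r n b)) x = E x u * E x (dd_start n)" if "x \<in> S" for x
      using DERIV_imp_deriv[OF D2[OF that]] by (simp only: eq E.eval_mult)
  qed
  note zeros_bound_Rolle[OF interval_S open_S s(1) this]
  note zeros_bound_Rolle[OF interval_S open_S s(2) this]
  then show ?thesis by simp
qed

end

theorem theorem2p2:
  fixes n :: nat and b :: real and a r :: "nat \<Rightarrow> real"
  assumes "1 \<le> n" and "0 < b"
  shows "finite (isolated_roots (phi a r n b) (dom_I a r n)) \<and>
    (\<Sum>x\<in>isolated_roots (phi a r n b) (dom_I a r n). root_mult (phi a r n b) x) \<le> DD n + 2"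
proof -
  interpret composite_power a r n .
  have "\<exists>k. dd_seq (n - 1) (dd_start n) k \<in> range const"
  \<comment> \<open>\<open>homogeneous\<close> includes being nonzero, so 0 is treated separately;
    it is already a constant.\<close>
  proof (cases "dd_start n = 0")
    case True
    then have "dd_seq (n - 1) (dd_start n) 0 = const 0" by (simp add: const_0)
    then show ?thesis by blast
  next
    case False
    then show ?thesis
      using dd_terminates[OF homogeneous_dd_start dd_start_laurent_ring, of n] by (simp add: dd_seq_funpow)
  qed
  then have "dd_seq (n - 1) (dd_start n) (DD n) \<in> range const"
    unfolding DD_def DD_poly_def by (rule LeastI_ex)
  then have "zeros_bound (\<lambda>t. E t (dd_start n)) S (DD n)"
    using zeros_bound_dd[OF dd_start_laurent_ring, of n "DD n"] by (simp add: dd_seq_funpow)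
  moreover have "dd_start n \<in> laurent_on low_vars"
    by (rule laurent_on_mono[OF _ dd_start_laurent_ring]) (auto simp: vars_def low_vars_def)
  ultimately have "zeros_bound (phi a r n b) (dom_I a r n) (DD n + 2)"
    using zeros_bound_deriv2[OF assms(1)] unfolding S_def by blast
  then show ?thesis by (rule zeros_bound_isolated[OF open_dom_I])
qed

end
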